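(* Let $c$ be a positive integer, $\mu>0$ and $\nu\in\mathbb{R}$. Let $R\in\Xi^\infty$ be such that $P=\langle R,R\rangle_R^D$ is a projection and $\langle R,R\rangle_L^E=\mathrm{Id}_E$. Let $\nabla$ be a compatible connection on $\Xi^\infty$ with curvature $\Theta_\nabla$. Then the topological charge $c_\nabla(P)=c_{XY}(P)+c_{XZ}(P)+c_{YZ}(P)$ of $P$ is given by \[ c_\nabla(P)=-\frac{1}{2\pi i}\,\tau_E\Big(\big\langle R,\big(\Theta_\nabla(X,Y)+\nabla_{[X,Y]}+\Theta_\nabla(X,Z)+\Theta_\nabla(Y,Z)\big)\cdot R\big\rangle_L^E\Big). \]
   Context: Notation: $\mathbb{T}=\mathbb{R}/\mathbb{Z}$, $M=\mathbb{R}\times\mathbb{T}$, $e(t)=\exp(2\pi it)$. Algebras: consider bounded continuous functions on $M\times\mathbb{Z}$ with compact support in the $\mathbb{Z}$-variable. $D_0$ consists of those with $\overline{e}(ckp(y-p\nu))\Phi(x+k,y,p)=\Phi(x,y,p)$ for all $k\in\mathbb{Z}$, with product $(\Phi*\Psi)(x,y,p)=\sum_q\Phi(x,y,q)\Psi(x-2q\mu,y-2q\nu,p-q)$ and involution $\Phi^*(x,y,p)=\overline\Phi(x-2p\mu,y-2p\nu,-p)$; the quantum Heisenberg manifold $D^c_{\mu\nu}$ is its closure in the multiplier algebra of $C_b(M)\rtimes_\lambda\mathbb{Z}$, $\lambda_p(x,y)=(x+2p\mu,y+2p\nu)$. $E_0$ consists of those with $e(cpk(y-k\nu))\Psi(x-2k\mu,y-2k\nu,p)=\Psi(x,y,p)$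 for all $k\in\mathbb{Z}$, and $E^c_{\mu\nu}$ is its closure in the multiplier algebra of $C_b(M)\rtimes_\sigma\mathbb{Z}$, $\sigma_p(x,y)=(x-p,y)$. $\mathrm{Id}_E(x,y,p)=\delta_0(p)$ is the unit of $E^c_{\mu\nu}$. Bimodule (Abadie): $\Xi$ is the completion of $C_c(M)$, a left-$E^c_{\mu\nu}$, right-$D^c_{\mu\nu}$ Morita equivalence bimodule, with inner products \[ \langle f,g\rangle_R^D(x,y,p)=\sum_{k}\overline e(ckp(y-p\nu))f(x+k,y)\overline g(x-2p\mu+k,y-2p\nu), \] \[ \langle f,g\rangle_L^E(x,y,p)=\sum_k e(cpk(y-k\nu))\overline f(x-2k\mu,y-2k\nu)g(x-2k\mu+p,y-2k\nu), \] and actions \[ (\Psi\cdot f)(x,y)=\sum_q\overline\Psi(x,y,q)f(x+q,y),\qquad (g\cdot\Phi)(x,y)=\sum_q g(x+2q\mu,y+2q\nu)\overline\Phi(x+2q\mu,y+2q\nu,q), \] satisfying $\langle f_1,f_2\rangle_L^E\cdot f_3=f_1\cdot\langle f_2,f_3\rangle_R^D$. Smooth structure: the Heisenberg group $H$ ($\mathbb{R}^3$ with product $(x,y,z)(x',y',z')=(x+x',y+y',z+z'+cyx')$) acts on $D^c_{\mu\nu}$ by $(L_{(r,s,t)}\Phi)(x,y,p)=e(p(t+cs(x-r-p\mu)))\Phi(x-r,y-s,p)$; $(D^c_{\mu\nu})^\infty$ is the subalgebra of smooth vectors in norm. The Lie algebra $\mathfrak h$ has basis $X=(0,1,0),Y=(1,0,0),Z=(0,0,1)$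 with $[X,Y]=cZ$, $Z$ central, acting by \[ \delta_X\Phi=2\pi icp(x-p\mu)\Phi-\partial_y\Phi,\quad\delta_Y\Phi=-\partial_x\Phi,\quad\delta_Z\Phi=2\pi ip\Phi, \] extended linearly in $V\in\mathfrak h$. By a lemma of Connes there is a dense left-$(E^c_{\mu\nu})^\infty$, right-$(D^c_{\mu\nu})^\infty$ sub-bimodule $\Xi^\infty\subset\Xi$, on which the inner products take values in the smooth algebras, where $(E^c_{\mu\nu})^\infty$ is the corresponding dense smooth subalgebra. Connections: a (linear) connection is a linear assignment $V\in\mathfrak h\mapsto\nabla_V:\Xi^\infty\to\Xi^\infty$ of linear maps with $\nabla_V(\xi\cdot\Phi)=(\nabla_V\xi)\cdot\Phi+\xi\cdot\delta_V(\Phi)$. It is compatible if \[ \delta_V(\langle\xi,\eta\rangle_R^D)=\langle\nabla_V\xi,\eta\rangle_R^D+\langle\xi,\nabla_V\eta\rangle_R^D \quad\text{and}\quad \delta_V(\langle\xi,\eta\rangle_L^E)=\langle\nabla_V\xi,\eta\rangle_L^E+\langle\xi,\nabla_V\eta\rangle_L^E \] for all $\xi,\eta\in\Xi^\infty$, where on elements $T$ of $(E^c_{\mu\nu})^\infty$, viewed as operators on $\Xi^\infty$ by the left action, $\delta_V(T)=[\nabla_V,T]$. The curvature is $\Theta_\nabla(V,W)=\nabla_V\nabla_W-\nabla_W\nabla_V-\nabla_{[V,W]}$, an operator on $\Xi^\infty$ commuting with the right action (given by the left action of an element of $E^c_{\mu\nu}$). For an operator $T$ on $\Xi^\infty$,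 $T\cdot R$ means $T(R)$. Traces: $\tau_D(\Phi)=\int_{\mathbb{T}^2}\Phi(x,y,0)\,dx\,dy$, and $\tau_E$ is the trace on $E^c_{\mu\nu}$ with $\tau_E(\langle\xi,\eta\rangle_L^E)=\tau_D(\langle\eta,\xi\rangle_R^D)$; explicitly $\tau_E(\Psi)=\int_{y=0}^{1}\int_{x=0}^{2\mu}\Psi(x,y,0)\,dx\,dy$. Topological charge: for $V,W\in\mathfrak h$, $c_{VW}(P)=\frac1{2\pi i}\tau_D\big(P(\delta_VP\,\delta_WP-\delta_WP\,\delta_VP)\big)$. *)

theory Defs
  imports "HOL-Analysis.Analysis" "HOL-Library.Function_Algebras"
begin

text \<open>
  Points of \<open>M = \<real> \<times> \<real>/\<int>\<close> are given by lifts in \<open>\<real> \<times> \<real>\<close>: a function on \<open>M\<close> is a function on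
  \<open>\<real> \<times> \<real>\<close> that is 1-periodic in the second coordinate. Sums and differences of functions are the
  pointwise ones (\<^theory>\<open>HOL-Library.Function_Algebras\<close>); the product of an algebra is
  always \<open>cp_mult\<close>, never the pointwise product.
\<close>

type_synonym mfun = "real \<times> real \<Rightarrow> complex"
type_synonym cpfun = "real \<times> real \<Rightarrow> int \<Rightarrow> complex"
type_synonym zaction = "int \<Rightarrow> real \<times> real \<Rightarrow> real \<times> real"
type_synonym heis = "real \<times> real \<times> real"

definition ee :: "real \<Rightarrow> complex" where
  "ee t = exp (2 * of_real pi * \<i> * of_real t)"

definition periodicM :: "mfun \<Rightarrow> bool" where
  "periodicM f \<longleftrightarrow> (\<forall>x y. f (x, y + 1) = f (x, y))"

definition CcM :: "mfun set" where
  "CcM = {f. periodicM f \<and> continuous_on UNIV f \<and> (\<exists>B. \<forall>x y. B < \<bar>x\<bar> \<longrightarrow> f (x, y) = 0)}"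


subsection \<open>Crossed products by the integers\<close>

definition cp_core :: "cpfun set" where
  "cp_core = {\<Phi>. (\<forall>p. periodicM (\<lambda>m. \<Phi> m p) \<and> continuous_on UNIV (\<lambda>m. \<Phi> m p)
                      \<and> bounded (range (\<lambda>m. \<Phi> m p)))
                \<and> finite {p. \<exists>m. \<Phi> m p \<noteq> 0}}"

definition cp_mult :: "zaction \<Rightarrow> cpfun \<Rightarrow> cpfun \<Rightarrow> cpfun" where
  "cp_mult \<alpha> \<Phi> \<Psi> = (\<lambda>m p. \<Sum>\<^sub>\<infinity>q. \<Phi> m q * \<Psi> (\<alpha> (- q) m) (p - q))"

definition cp_star :: "zaction \<Rightarrow> cpfun \<Rightarrow> cpfun" where
  "cp_star \<alpha> \<Phi> = (\<lambda>m p. cnj (\<Phi> (\<alpha> (- p) m) (- p)))"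

definition cp_unit :: cpfun where
  "cp_unit = (\<lambda>m p. if p = 0 then 1 else 0)"

definition cp_regular :: "zaction \<Rightarrow> cpfun \<Rightarrow> real \<times> real \<Rightarrow> (int \<Rightarrow> complex) \<Rightarrow> int \<Rightarrow> complex" where
  "cp_regular \<alpha> \<Phi> m \<xi> = (\<lambda>p. \<Sum>q | \<xi> q \<noteq> 0. \<Phi> (\<alpha> p m) (p - q) * \<xi> q)"

text \<open>
  \<open>cp_regular \<alpha> \<Phi> m\<close> is the operator of \<open>\<Phi>\<close> on \<open>\<ell>\<^sup>2(\<int>)\<close>, on finitely supported
  vectors, in the regular representation of \<open>C\<^sub>b(M) \<rtimes>\<^sub>\<alpha> \<int>\<close> induced from evaluation at \<open>m\<close>. The
  evaluations are jointly faithful on \<open>C\<^sub>b(M)\<close> and \<open>\<int>\<close> is amenable, so the supremum over \<open>m\<close> of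
  the operator norms is the norm of \<open>C\<^sub>b(M) \<rtimes>\<^sub>\<alpha> \<int>\<close>; since \<open>C\<^sub>b(M)\<close> is unital, this algebra is its own
  multiplier algebra. \<open>cp_norm\<close> is that supremum, written as the least common bound; it is
  \<open>\<infinity>\<close> if there is no bound.
\<close>

definition cp_norm :: "zaction \<Rightarrow> cpfun \<Rightarrow> ennreal" where
  "cp_norm \<alpha> \<Phi> = Inf (ennreal ` {C. 0 \<le> C \<and>
     (\<forall>m \<xi>. finite {q. \<xi> q \<noteq> 0} \<longrightarrow>
        (\<Sum>\<^sub>\<infinity>p. ennreal ((cmod (cp_regular \<alpha> \<Phi> m \<xi> p))\<^sup>2))
          \<le> ennreal (C\<^sup>2 * (\<Sum>q | \<xi> q \<noteq> 0. (cmod (\<xi> q))\<^sup>2)))})"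

text \<open>
  An element of the crossed product is identified with the function of its Fourier coefficients
  \<open>\<Phi>(\<cdot>, p)\<close>, which are the matrix coefficients of the operators above and hence determine it.
  The closure of a subalgebra is therefore again a set of functions on \<open>M \<times> \<int>\<close>, on which
  \<open>cp_norm\<close> is the norm and \<open>cp_mult\<close>, now an absolutely convergent series (by Cauchy-Schwarz),
  and \<open>cp_star\<close> are the operations.
\<close>

definition cp_closure :: "zaction \<Rightarrow> cpfun set \<Rightarrow> cpfun set" where
  "cp_closure \<alpha> S = {\<Phi>. \<exists>F. (\<forall>n. F n \<in> S) \<and> (\<lambda>n. cp_norm \<alpha> (\<Phi> - F n)) \<longlonglongrightarrow> 0}"


subsection \<open>Quantum Heisenberg manifolds\<close>

definition lam :: "real \<Rightarrow> real \<Rightarrow> zaction" where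
  "lam \<mu> \<nu> = (\<lambda>p (x, y). (x + 2 * of_int p * \<mu>, y + 2 * of_int p * \<nu>))"

definition sig :: zaction where
  "sig = (\<lambda>p (x, y). (x - of_int p, y))"

definition D0 :: "int \<Rightarrow> real \<Rightarrow> cpfun set" where
  "D0 c \<nu> = {\<Phi> \<in> cp_core. \<forall>k x y p.
     cnj (ee (of_int (c * k * p) * (y - of_int p * \<nu>))) * \<Phi> (x + of_int k, y) p = \<Phi> (x, y) p}"

definition E0 :: "int \<Rightarrow> real \<Rightarrow> real \<Rightarrow> cpfun set" where
  "E0 c \<mu> \<nu> = {\<Psi> \<in> cp_core. \<forall>k x y p.
     ee (of_int (c * p * k) * (y - of_int k * \<nu>))
       * \<Psi> (x - 2 * of_int k * \<mu>, y - 2 * of_int k * \<nu>) p = \<Psi> (x, y) p}"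

definition D_alg :: "int \<Rightarrow> real \<Rightarrow> real \<Rightarrow> cpfun set" where
  "D_alg c \<mu> \<nu> = cp_closure (lam \<mu> \<nu>) (D0 c \<nu>)"

definition E_alg :: "int \<Rightarrow> real \<Rightarrow> real \<Rightarrow> cpfun set" where
  "E_alg c \<mu> \<nu> = cp_closure sig (E0 c \<mu> \<nu>)"

definition projD :: "int \<Rightarrow> real \<Rightarrow> real \<Rightarrow> cpfun \<Rightarrow> bool" where
  "projD c \<mu> \<nu> P \<longleftrightarrow> P \<in> D_alg c \<mu> \<nu> \<and> cp_star (lam \<mu> \<nu>) P = P \<and> cp_mult (lam \<mu> \<nu>) P P = P"

definition tauD :: "cpfun \<Rightarrow> complex" where
  "tauD \<Phi> = integral (cbox (0, 0) (1, 1)) (\<lambda>m. \<Phi> m 0)"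

definition tauE :: "real \<Rightarrow> cpfun \<Rightarrow> complex" where
  "tauE \<mu> \<Psi> = integral {0..1} (\<lambda>y. integral {0..2 * \<mu>} (\<lambda>x. \<Psi> (x, y) 0))"


subsection \<open>The bimodule\<close>

text \<open>\<open>ipD\<close> is conjugate linear in the second argument and \<open>ipE\<close> in the first, and both actions
  are conjugate linear in the algebra element.\<close>

definition ipD :: "int \<Rightarrow> real \<Rightarrow> real \<Rightarrow> mfun \<Rightarrow> mfun \<Rightarrow> cpfun" where
  "ipD c \<mu> \<nu> f g = (\<lambda>(x, y) p. \<Sum>\<^sub>\<infinity>k::int.
     cnj (ee (of_int (c * k * p) * (y - of_int p * \<nu>))) * f (x + of_int k, y)
       * cnj (g (x - 2 * of_int p * \<mu> + of_int k, y - 2 * of_int p * \<nu>)))"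

definition ipE :: "int \<Rightarrow> real \<Rightarrow> real \<Rightarrow> mfun \<Rightarrow> mfun \<Rightarrow> cpfun" where
  "ipE c \<mu> \<nu> f g = (\<lambda>(x, y) p. \<Sum>\<^sub>\<infinity>k::int.
     ee (of_int (c * p * k) * (y - of_int k * \<nu>)) * cnj (f (x - 2 * of_int k * \<mu>, y - 2 * of_int k * \<nu>))
       * g (x - 2 * of_int k * \<mu> + of_int p, y - 2 * of_int k * \<nu>))"

definition actE :: "cpfun \<Rightarrow> mfun \<Rightarrow> mfun" where
  "actE \<Psi> f = (\<lambda>(x, y). \<Sum>\<^sub>\<infinity>q::int. cnj (\<Psi> (x, y) q) * f (x + of_int q, y))"

definition actD :: "real \<Rightarrow> real \<Rightarrow> mfun \<Rightarrow> cpfun \<Rightarrow> mfun" where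
  "actD \<mu> \<nu> g \<Phi> = (\<lambda>(x, y). \<Sum>\<^sub>\<infinity>q::int.
     g (x + 2 * of_int q * \<mu>, y + 2 * of_int q * \<nu>)
       * cnj (\<Phi> (x + 2 * of_int q * \<mu>, y + 2 * of_int q * \<nu>) q))"

definition Xi_normsq :: "int \<Rightarrow> real \<Rightarrow> real \<Rightarrow> mfun \<Rightarrow> ennreal" where
  "Xi_normsq c \<mu> \<nu> f = cp_norm (lam \<mu> \<nu>) (ipD c \<mu> \<nu> f f)"

text \<open>
  The Hilbert module norm dominates the supremum norm on \<open>C\<^sub>c(M)\<close>, and a Cauchy sequence that
  converges uniformly to \<open>0\<close> has limit \<open>0\<close> in \<open>\<Xi>\<close>; so the completion \<open>\<Xi>\<close> is a set of functions on
  \<open>M\<close>, on which the inner products and actions are still given by the (absolutely convergent)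
  series above. The summability condition holds for all elements of \<open>\<Xi>\<close>; without it \<open>ipD f f\<close>
  could be the junk value of a divergent series.
\<close>

definition Xi :: "int \<Rightarrow> real \<Rightarrow> real \<Rightarrow> mfun set" where
  "Xi c \<mu> \<nu> = {f. (\<forall>x y. (\<lambda>k::int. (cmod (f (x + of_int k, y)))\<^sup>2) summable_on UNIV) \<and>
     (\<exists>F. (\<forall>n. F n \<in> CcM) \<and> (\<lambda>n. Xi_normsq c \<mu> \<nu> (f - F n)) \<longlonglongrightarrow> 0)}"


subsection \<open>The Heisenberg action and smooth elements\<close>

definition heis_act :: "int \<Rightarrow> real \<Rightarrow> heis \<Rightarrow> cpfun \<Rightarrow> cpfun" where
  "heis_act c \<mu> = (\<lambda>(r, s, t) \<Phi> (x, y) p.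
     ee (of_int p * (t + of_int c * s * (x - r - of_int p * \<mu>))) * \<Phi> (x - r, y - s) p)"

text \<open>Smoothness in norm of a map on \<open>\<real>\<^sup>3\<close>: \<open>G [v\<^sub>n, \<dots>, v\<^sub>1]\<close> is the iterated partial
  derivative \<open>\<partial>\<^sub>v\<^sub>n \<dots> \<partial>\<^sub>v\<^sub>1 F\<close>, and all of these exist and are continuous.\<close>

definition cp_smooth :: "zaction \<Rightarrow> (heis \<Rightarrow> cpfun) \<Rightarrow> bool" where
  "cp_smooth \<alpha> F \<longleftrightarrow> (\<exists>G :: heis list \<Rightarrow> heis \<Rightarrow> cpfun. G [] = F \<and>
     (\<forall>vs h. set vs \<subseteq> Basis \<longrightarrow>
        ((\<lambda>k. cp_norm \<alpha> (G vs k - G vs h)) \<longlongrightarrow> 0) (at h) \<and>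
        (\<forall>v\<in>Basis. ((\<lambda>t::real. cp_norm \<alpha> (\<lambda>m p.
            (G vs (h + t *\<^sub>R v) m p - G vs h m p) / of_real t - G (v # vs) h m p)) \<longlongrightarrow> 0) (at 0))))"

definition D_smooth :: "int \<Rightarrow> real \<Rightarrow> real \<Rightarrow> cpfun set" where
  "D_smooth c \<mu> \<nu> = {\<Phi> \<in> D_alg c \<mu> \<nu>. cp_smooth (lam \<mu> \<nu>) (\<lambda>h. heis_act c \<mu> h \<Phi>)}"

text \<open>Elements of the Lie algebra are written in the coordinates of \<open>H\<close>, so that
  \<open>(v\<^sub>1, v\<^sub>2, v\<^sub>3) = v\<^sub>2 X + v\<^sub>1 Y + v\<^sub>3 Z\<close>.\<close>

definition hX :: heis where "hX = (0, 1, 0)"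
definition hY :: heis where "hY = (1, 0, 0)"
definition hZ :: heis where "hZ = (0, 0, 1)"

definition heis_bracket :: "int \<Rightarrow> heis \<Rightarrow> heis \<Rightarrow> heis" where
  "heis_bracket c = (\<lambda>(v1, v2, v3) (w1, w2, w3). (of_int c * (v2 * w1 - v1 * w2)) *\<^sub>R hZ)"

definition delta_X :: "int \<Rightarrow> real \<Rightarrow> cpfun \<Rightarrow> cpfun" where
  "delta_X c \<mu> \<Phi> = (\<lambda>(x, y) p.
     2 * of_real pi * \<i> * of_int c * of_int p * of_real (x - of_int p * \<mu>) * \<Phi> (x, y) p
       - vector_derivative (\<lambda>s. \<Phi> (x, s) p) (at y))"

definition delta_Y :: "cpfun \<Rightarrow> cpfun" where
  "delta_Y \<Phi> = (\<lambda>(x, y) p. - vector_derivative (\<lambda>s. \<Phi> (s, y) p) (at x))"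

definition delta_Z :: "cpfun \<Rightarrow> cpfun" where
  "delta_Z \<Phi> = (\<lambda>m p. 2 * of_real pi * \<i> * of_int p * \<Phi> m p)"

definition delta :: "int \<Rightarrow> real \<Rightarrow> heis \<Rightarrow> cpfun \<Rightarrow> cpfun" where
  "delta c \<mu> = (\<lambda>(v1, v2, v3) \<Phi> m p.
     of_real v2 * delta_X c \<mu> \<Phi> m p + of_real v1 * delta_Y \<Phi> m p + of_real v3 * delta_Z \<Phi> m p)"

text \<open>The data \<open>(E\<^sup>\<infinity>, \<Xi>\<^sup>\<infinity>)\<close> provided by the lemma of Connes: a dense subalgebra of \<open>E\<close> and a
  dense sub-bimodule of \<open>\<Xi>\<close> over it and the smooth elements of \<open>D\<close>.\<close>

definition smooth_bimodule :: "int \<Rightarrow> real \<Rightarrow> real \<Rightarrow> cpfun set \<Rightarrow> mfun set \<Rightarrow> bool" where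
  "smooth_bimodule c \<mu> \<nu> Einf Xinf \<longleftrightarrow>
     Einf \<subseteq> E_alg c \<mu> \<nu> \<and> 0 \<in> Einf \<and>
     (\<forall>S\<in>Einf. \<forall>T\<in>Einf. S + T \<in> Einf \<and> cp_mult sig S T \<in> Einf) \<and>
     (\<forall>a. \<forall>T\<in>Einf. (\<lambda>m p. a * T m p) \<in> Einf) \<and>
     E_alg c \<mu> \<nu> \<subseteq> cp_closure sig Einf \<and>
     Xinf \<subseteq> Xi c \<mu> \<nu> \<and> 0 \<in> Xinf \<and>
     (\<forall>\<xi>\<in>Xinf. \<forall>\<eta>\<in>Xinf. \<xi> + \<eta> \<in> Xinf) \<and>
     (\<forall>a. \<forall>\<xi>\<in>Xinf. (\<lambda>m. a * \<xi> m) \<in> Xinf) \<and>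
     (\<forall>f\<in>Xi c \<mu> \<nu>. \<exists>F. (\<forall>n. F n \<in> Xinf) \<and> (\<lambda>n. Xi_normsq c \<mu> \<nu> (f - F n)) \<longlonglongrightarrow> 0) \<and>
     (\<forall>T\<in>Einf. \<forall>\<xi>\<in>Xinf. actE T \<xi> \<in> Xinf) \<and>
     (\<forall>\<xi>\<in>Xinf. \<forall>\<Phi>\<in>D_smooth c \<mu> \<nu>. actD \<mu> \<nu> \<xi> \<Phi> \<in> Xinf) \<and>
     (\<forall>\<xi>\<in>Xinf. \<forall>\<eta>\<in>Xinf. ipD c \<mu> \<nu> \<xi> \<eta> \<in> D_smooth c \<mu> \<nu> \<and> ipE c \<mu> \<nu> \<xi> \<eta> \<in> Einf)"


subsection \<open>Connections, curvature and topological charge\<close>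

definition is_connection :: "int \<Rightarrow> real \<Rightarrow> real \<Rightarrow> mfun set \<Rightarrow> (heis \<Rightarrow> mfun \<Rightarrow> mfun) \<Rightarrow> bool" where
  "is_connection c \<mu> \<nu> Xinf N \<longleftrightarrow>
     (\<forall>V. \<forall>\<xi>\<in>Xinf. N V \<xi> \<in> Xinf) \<and>
     (\<forall>V W. \<forall>\<xi>\<in>Xinf. N (V + W) \<xi> = N V \<xi> + N W \<xi>) \<and>
     (\<forall>a V. \<forall>\<xi>\<in>Xinf. N (a *\<^sub>R V) \<xi> = (\<lambda>m. of_real a * N V \<xi> m)) \<and>
     (\<forall>V. \<forall>\<xi>\<in>Xinf. \<forall>\<eta>\<in>Xinf. N V (\<xi> + \<eta>) = N V \<xi> + N V \<eta>) \<and>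
     (\<forall>V a. \<forall>\<xi>\<in>Xinf. N V (\<lambda>m. a * \<xi> m) = (\<lambda>m. a * N V \<xi> m)) \<and>
     (\<forall>V. \<forall>\<xi>\<in>Xinf. \<forall>\<Phi>\<in>D_smooth c \<mu> \<nu>.
        N V (actD \<mu> \<nu> \<xi> \<Phi>) = actD \<mu> \<nu> (N V \<xi>) \<Phi> + actD \<mu> \<nu> \<xi> (delta c \<mu> V \<Phi>))"

text \<open>\<open>\<delta>\<^sub>V(T) = [\<nabla>\<^sub>V, T]\<close>, for \<open>T\<close> in \<open>E\<^sup>\<infinity>\<close>, is an operator on \<open>\<Xi>\<^sup>\<infinity>\<close>; the second compatibility
  condition is thus an equality of operators on \<open>\<Xi>\<^sup>\<infinity>\<close>.\<close>

definition deltaE :: "(heis \<Rightarrow> mfun \<Rightarrow> mfun) \<Rightarrow> heis \<Rightarrow> cpfun \<Rightarrow> mfun \<Rightarrow> mfun" where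
  "deltaE N V T \<zeta> = N V (actE T \<zeta>) - actE T (N V \<zeta>)"

definition is_compatible :: "int \<Rightarrow> real \<Rightarrow> real \<Rightarrow> mfun set \<Rightarrow> (heis \<Rightarrow> mfun \<Rightarrow> mfun) \<Rightarrow> bool" where
  "is_compatible c \<mu> \<nu> Xinf N \<longleftrightarrow> (\<forall>V. \<forall>\<xi>\<in>Xinf. \<forall>\<eta>\<in>Xinf.
     delta c \<mu> V (ipD c \<mu> \<nu> \<xi> \<eta>) = ipD c \<mu> \<nu> (N V \<xi>) \<eta> + ipD c \<mu> \<nu> \<xi> (N V \<eta>) \<and>
     (\<forall>\<zeta>\<in>Xinf. deltaE N V (ipE c \<mu> \<nu> \<xi> \<eta>) \<zeta>
        = actE (ipE c \<mu> \<nu> (N V \<xi>) \<eta> + ipE c \<mu> \<nu> \<xi> (N V \<eta>)) \<zeta>))"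

definition curvature :: "int \<Rightarrow> (heis \<Rightarrow> mfun \<Rightarrow> mfun) \<Rightarrow> heis \<Rightarrow> heis \<Rightarrow> mfun \<Rightarrow> mfun" where
  "curvature c N V W \<xi> = N V (N W \<xi>) - N W (N V \<xi>) - N (heis_bracket c V W) \<xi>"

definition charge2 :: "int \<Rightarrow> real \<Rightarrow> real \<Rightarrow> heis \<Rightarrow> heis \<Rightarrow> cpfun \<Rightarrow> complex" where
  "charge2 c \<mu> \<nu> V W P = 1 / (2 * of_real pi * \<i>) * tauD (cp_mult (lam \<mu> \<nu>) P
     (cp_mult (lam \<mu> \<nu>) (delta c \<mu> V P) (delta c \<mu> W P)
        - cp_mult (lam \<mu> \<nu>) (delta c \<mu> W P) (delta c \<mu> V P)))"

definition top_charge :: "int \<Rightarrow> real \<Rightarrow> real \<Rightarrow> cpfun \<Rightarrow> complex" where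
  "top_charge c \<mu> \<nu> P =
     charge2 c \<mu> \<nu> hX hY P + charge2 c \<mu> \<nu> hX hZ P + charge2 c \<mu> \<nu> hY hZ P"

end

theory Submission
  imports Defs
begin

text \<open>
  At each base point an element \<open>f\<close> of the bimodule is a bounded matrix \<open>A(f)\<close> over \<open>\<int> \<times> \<int>\<close>, in such a
  way that the right inner product of \<open>f\<close> and \<open>g\<close> is \<open>A(f) A(g)\<^sup>*\<close>, the left one is \<open>A(f)\<^sup>* A(g)\<close>, and
  \<open>f \<cdot> \<langle>g, h\<rangle>\<^sub>R\<close> has matrix \<open>A(h) A(g)\<^sup>* A(f)\<close>. Let \<open>r\<close>, \<open>a\<close>, \<open>b\<close> be the matrices of \<open>R\<close>, \<open>\<nabla>\<^sub>V R\<close>, \<open>\<nabla>\<^sub>W R\<close>.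
  Then \<open>r\<^sup>* r = 1\<close>, and since \<open>\<delta>\<^sub>V\<close> kills the unit, \<open>s = r\<^sup>* a\<close> and \<open>t = r\<^sup>* b\<close> are skew-adjoint. With
  \<open>\<delta>\<^sub>V P = a r\<^sup>* + r a\<^sup>*\<close> one gets \<open>P [\<delta>\<^sub>V P, \<delta>\<^sub>W P] = r (s t - t s + a\<^sup>* b - b\<^sup>* a) r\<^sup>*\<close>, whose trace is
  that of \<open>a\<^sup>* b - b\<^sup>* a\<close>. Both traces are the integral of \<open>f\<close> times the conjugate of \<open>g\<close> over
  \<open>\<real> \<times> \<real>/\<int>\<close>, folded along two different lattices, so \<open>\<tau>\<^sub>D(A(f) A(g)\<^sup>*) = \<tau>\<^sub>E(A(g)\<^sup>* A(f))\<close>. Finally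
  \<open>\<tau>\<^sub>D \<circ> \<delta>\<^sub>V = 0\<close> turns \<open>\<tau>\<^sub>E(a\<^sup>* b)\<close> into \<open>- \<tau>\<^sub>E\<langle>R, \<nabla>\<^sub>V \<nabla>\<^sub>W R\<rangle>\<close>.
\<close>

section \<open>Square-summable sequences\<close>

definition ell2 :: "(int \<Rightarrow> complex) \<Rightarrow> bool" where
  "ell2 x \<longleftrightarrow> (\<lambda>k. (cmod (x k))\<^sup>2) summable_on UNIV"

definition l2norm :: "(int \<Rightarrow> complex) \<Rightarrow> real" where
  "l2norm x = sqrt (\<Sum>\<^sub>\<infinity>k. (cmod (x k))\<^sup>2)"

abbreviation l2on :: "int set \<Rightarrow> (int \<Rightarrow> complex) \<Rightarrow> real" where
  "l2on F x \<equiv> L2_set (\<lambda>k. cmod (x k)) F"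

lemma l2norm_nonneg: "0 \<le> l2norm x"
  by (simp add: l2norm_def infsum_nonneg)

lemma l2on_le_l2norm: "ell2 x \<Longrightarrow> finite F \<Longrightarrow> l2on F x \<le> l2norm x"
  unfolding ell2_def l2norm_def L2_set_def
  by (intro real_sqrt_le_mono finite_sum_le_infsum) auto

lemma ell2_if_l2on_le:
  assumes "\<And>F. finite F \<Longrightarrow> l2on F x \<le> B"
  shows "ell2 x" "l2norm x \<le> B"
proof -
  have B: "0 \<le> B"
    using assms[of "{}"] by simp
  have le: "(\<Sum>k\<in>F. (cmod (x k))\<^sup>2) \<le> B\<^sup>2" if "finite F" for F
    using assms[OF that] by (simp add: L2_set_def real_sqrt_le_iff' sum_nonneg B sqrt_le_D)
  show x: "ell2 x"
    unfolding ell2_def by (rule nonneg_bounded_partial_sums_imp_summable_on[where C = "B\<^sup>2"])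
      (auto intro!: always_eventually le eventually_finite_subsets_at_top_weakI)
  have "(\<Sum>\<^sub>\<infinity>k. (cmod (x k))\<^sup>2) \<le> B\<^sup>2"
    using x le unfolding ell2_def by (intro infsum_le_finite_sums) auto
  then show "l2norm x \<le> B"
    unfolding l2norm_def using B real_le_lsqrt by blast
qed

lemma ell2_finite: "finite {k. x k \<noteq> 0} \<Longrightarrow> ell2 x"
  unfolding ell2_def
  by (rule summable_on_cong_neutral[THEN iffD1, OF _ _ _ summable_on_finite]) auto

lemma ell2_cnj [simp]: "ell2 (\<lambda>k. cnj (x k)) \<longleftrightarrow> ell2 x"
  by (simp add: ell2_def)

text \<open>Cauchy-Schwarz on every finite set bounds the partial sums of the absolute values, so
  the series converges absolutely and inherits the bound.\<close>

lemma
  assumes "ell2 x" "ell2 y"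
  shows ell2_mult_summable: "(\<lambda>k. x k * y k) summable_on UNIV"
    and ell2_mult_bound: "cmod (\<Sum>\<^sub>\<infinity>k. x k * y k) \<le> l2norm x * l2norm y"
proof -
  have le: "(\<Sum>k\<in>F. cmod (x k * y k)) \<le> l2norm x * l2norm y" if "finite F" for F
  proof -
    have "(\<Sum>k\<in>F. cmod (x k * y k)) \<le> l2on F x * l2on F y"
      using L2_set_mult_ineq[of "\<lambda>k. cmod (x k)" "\<lambda>k. cmod (y k)" F] by (simp add: norm_mult)
    also have "\<dots> \<le> l2norm x * l2norm y"
      using assms that by (intro mult_mono l2on_le_l2norm) (auto simp: l2norm_nonneg)
    finally show ?thesis .
  qed
  have abs: "(\<lambda>k. cmod (x k * y k)) summable_on UNIV"
    by (rule nonneg_bounded_partial_sums_imp_summable_on[where C = "l2norm x * l2norm y"])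
      (auto intro!: le eventually_finite_subsets_at_top_weakI)
  then show "(\<lambda>k. x k * y k) summable_on UNIV"
    by (rule abs_summable_summable)
  have "cmod (\<Sum>\<^sub>\<infinity>k. x k * y k) \<le> (\<Sum>\<^sub>\<infinity>k. cmod (x k * y k))"
    by (rule norm_infsum_bound[OF abs])
  also have "\<dots> \<le> l2norm x * l2norm y"
    using abs le by (intro infsum_le_finite_sums) auto
  finally show "cmod (\<Sum>\<^sub>\<infinity>k. x k * y k) \<le> l2norm x * l2norm y" .
qed

lemma ell2_add:
  assumes "ell2 x" "ell2 y"
  shows "ell2 (\<lambda>k. x k + y k)"
proof (rule ell2_if_l2on_le)
  fix F :: "int set" assume F: "finite F"
  have "l2on F (\<lambda>k. x k + y k) \<le> L2_set (\<lambda>k. cmod (x k) + cmod (y k)) F"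
    by (intro L2_set_mono norm_triangle_ineq) auto
  also have "\<dots> \<le> l2on F x + l2on F y"
    by (rule L2_set_triangle_ineq)
  also have "\<dots> \<le> l2norm x + l2norm y"
    using assms F by (intro add_mono l2on_le_l2norm)
  finally show "l2on F (\<lambda>k. x k + y k) \<le> l2norm x + l2norm y" .
qed

lemma ell2_cmult: "ell2 x \<Longrightarrow> ell2 (\<lambda>k. a * x k)"
  unfolding ell2_def by (simp add: norm_mult power_mult_distrib summable_on_cmult_right)

lemma infsum_sum:
  fixes f :: "'a \<Rightarrow> 'b \<Rightarrow> complex"
  assumes "\<And>a. a \<in> F \<Longrightarrow> f a summable_on A"
  shows "(\<Sum>\<^sub>\<infinity>b\<in>A. \<Sum>a\<in>F. f a b) = (\<Sum>a\<in>F. infsum (f a) A)"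
    and "(\<lambda>b. \<Sum>a\<in>F. f a b) summable_on A"
proof -
  have "(\<Sum>\<^sub>\<infinity>b\<in>A. \<Sum>a\<in>F. f a b) = (\<Sum>a\<in>F. infsum (f a) A) \<and> (\<lambda>b. \<Sum>a\<in>F. f a b) summable_on A"
    using assms by (induction F rule: infinite_finite_induct) (auto simp: infsum_add summable_on_add)
  then show "(\<Sum>\<^sub>\<infinity>b\<in>A. \<Sum>a\<in>F. f a b) = (\<Sum>a\<in>F. infsum (f a) A)"
    and "(\<lambda>b. \<Sum>a\<in>F. f a b) summable_on A"
    by auto
qed

section \<open>Bounded matrices over the integers\<close>

text \<open>This says that \<open>M\<close> is the matrix of an operator on square-summable
  sequences of norm at most \<open>C\<close>. Testing on finite sections only avoids convergence
  questions, and the form is bilinear rather than sesquilinear, so that transposition is a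
  symmetry.\<close>

definition bdd_by :: "real \<Rightarrow> (int \<Rightarrow> int \<Rightarrow> complex) \<Rightarrow> bool" where
  "bdd_by C M \<longleftrightarrow> 0 \<le> C \<and> (\<forall>F G x y. finite F \<longrightarrow> finite G \<longrightarrow>
     cmod (\<Sum>p\<in>F. \<Sum>q\<in>G. x p * M p q * y q) \<le> C * l2on F x * l2on G y)"

lemma bdd_byD:
  "bdd_by C M \<Longrightarrow> finite F \<Longrightarrow> finite G \<Longrightarrow>
    cmod (\<Sum>p\<in>F. \<Sum>q\<in>G. x p * M p q * y q) \<le> C * l2on F x * l2on G y"
  by (simp add: bdd_by_def)

lemma bdd_by_nonneg: "bdd_by C M \<Longrightarrow> 0 \<le> C"
  by (simp add: bdd_by_def)

lemma bdd_by_transpose: 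
  assumes "bdd_by C M"
  shows "bdd_by C (\<lambda>p q. M q p)"
  unfolding bdd_by_def
proof (intro conjI allI impI)
  fix F G :: "int set" and x y assume "finite F" "finite G"
  then have "cmod (\<Sum>q\<in>G. \<Sum>p\<in>F. y q * M q p * x p) \<le> C * l2on G y * l2on F x"
    by (intro bdd_byD assms)
  then show "cmod (\<Sum>p\<in>F. \<Sum>q\<in>G. x p * M q p * y q) \<le> C * l2on F x * l2on G y"
    by (subst sum.swap) (simp add: mult_ac)
qed (use assms bdd_by_nonneg in auto)

lemma bdd_by_cnj:
  assumes "bdd_by C M"
  shows "bdd_by C (\<lambda>p q. cnj (M p q))"
  unfolding bdd_by_def
proof (intro conjI allI impI)
  fix F G :: "int set" and x y assume "finite F" "finite G"
  then have "cmod (\<Sum>p\<in>F. \<Sum>q\<in>G. cnj (x p) * M p q * cnj (y q)) \<le> C * l2on F (\<lambda>p. cnj (x p)) * l2on G (\<lambda>q. cnj (y q))"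
    by (intro bdd_byD assms)
  also have "(\<Sum>p\<in>F. \<Sum>q\<in>G. cnj (x p) * M p q * cnj (y q)) = cnj (\<Sum>p\<in>F. \<Sum>q\<in>G. x p * cnj (M p q) * y q)"
    by simp
  finally show "cmod (\<Sum>p\<in>F. \<Sum>q\<in>G. x p * cnj (M p q) * y q) \<le> C * l2on F x * l2on G y"
    by (simp only: complex_mod_cnj)
qed (use assms bdd_by_nonneg in auto)

text \<open>The hypothesis is what testing \<open>z\<close> against its own conjugate yields. Its
  left side is the squared norm, so one factor of the norm cancels.\<close>

lemma l2on_le_by_duality:
  assumes C: "0 \<le> C"
    and bound: "cmod (\<Sum>q\<in>G. z q * cnj (z q)) \<le> C * l2on G (\<lambda>q. cnj (z q))"
  shows "l2on G z \<le> C"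
proof -
  have "(\<Sum>q\<in>G. z q * cnj (z q)) = of_real ((l2on G z)\<^sup>2)"
    by (simp add: L2_set_def sum_nonneg complex_norm_square del: of_real_power)
  then have "(l2on G z)\<^sup>2 \<le> C * l2on G z"
    using bound by (simp add: L2_set_nonneg norm_power)
  then show ?thesis
    using C L2_set_nonneg[of "\<lambda>q. cmod (z q)" G] by (cases "l2on G z = 0") (auto simp: power2_eq_square)
qed

lemma bdd_by_finite_row:
  assumes "bdd_by C M" "finite F"
  shows "ell2 (\<lambda>q. \<Sum>p\<in>F. x p * M p q)" "l2norm (\<lambda>q. \<Sum>p\<in>F. x p * M p q) \<le> C * l2on F x"
proof -
  have "l2on G (\<lambda>q. \<Sum>p\<in>F. x p * M p q) \<le> C * l2on F x" if "finite G" for G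
  proof (rule l2on_le_by_duality)
    show "cmod (\<Sum>q\<in>G. (\<Sum>p\<in>F. x p * M p q) * cnj (\<Sum>p\<in>F. x p * M p q))
      \<le> C * l2on F x * l2on G (\<lambda>q. cnj (\<Sum>p\<in>F. x p * M p q))"
      using bdd_byD[OF assms that, of x "\<lambda>q. cnj (\<Sum>p\<in>F. x p * M p q)"]
      by (subst (asm) sum.swap) (simp only: sum_distrib_right)
  qed (use assms bdd_by_nonneg in \<open>auto simp: L2_set_nonneg\<close>)
  from ell2_if_l2on_le[OF this] show "ell2 (\<lambda>q. \<Sum>p\<in>F. x p * M p q)" 
    "l2norm (\<lambda>q. \<Sum>p\<in>F. x p * M p q) \<le> C * l2on F x"
    by blast+
qed

lemma bdd_by_finite_col:
  assumes "bdd_by C M" "finite F"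
  shows "ell2 (\<lambda>p. \<Sum>q\<in>F. M p q * x q)" "l2norm (\<lambda>p. \<Sum>q\<in>F. M p q * x q) \<le> C * l2on F x"
  using bdd_by_finite_row[OF bdd_by_transpose[OF assms(1)] assms(2), of x] by (simp_all add: mult_ac)

lemma bdd_by_row: "bdd_by C M \<Longrightarrow> ell2 (M p)"
  using bdd_by_finite_row(1)[of C M "{p}" "\<lambda>_. 1"] by simp

lemma bdd_by_col: "bdd_by C M \<Longrightarrow> ell2 (\<lambda>p. M p q)"
  using bdd_by_row[OF bdd_by_transpose] .

text \<open>The sum over the finite set \<open>G\<close> passes through the series; Cauchy-Schwarz
  against a finite combination of columns and duality then give the bound.\<close>

lemma bdd_by_infinite_row:
  assumes M: "bdd_by C M" and x: "ell2 x"
  shows "ell2 (\<lambda>q. \<Sum>\<^sub>\<infinity>p. x p * M p q)" "l2norm (\<lambda>q. \<Sum>\<^sub>\<infinity>p. x p * M p q) \<le> C * l2norm x"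
proof -
  define z where "z q = (\<Sum>\<^sub>\<infinity>p. x p * M p q)" for q
  have "l2on G z \<le> C * l2norm x" if G: "finite G" for G
  proof (rule l2on_le_by_duality)
    have s: "(\<lambda>p. x p * M p q * y) summable_on UNIV" for q y
      by (intro summable_on_cmult_left ell2_mult_summable x bdd_by_col[OF M])
    have "(\<Sum>q\<in>G. z q * cnj (z q)) = (\<Sum>q\<in>G. \<Sum>\<^sub>\<infinity>p. x p * M p q * cnj (z q))"
      unfolding z_def by (intro sum.cong refl infsum_cmult_left' [symmetric])
    also have "\<dots> = (\<Sum>\<^sub>\<infinity>p. x p * (\<Sum>q\<in>G. M p q * cnj (z q)))"
      by (subst infsum_sum(1)[symmetric]) (simp_all only: s sum_distrib_left mult.assoc[symmetric])
    also have "cmod \<dots> \<le> l2norm x * l2norm (\<lambda>p. \<Sum>q\<in>G. M p q * cnj (z q))"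
      by (intro ell2_mult_bound x bdd_by_finite_col[OF M G])
    also have "\<dots> \<le> l2norm x * (C * l2on G (\<lambda>q. cnj (z q)))"
      by (intro mult_left_mono bdd_by_finite_col[OF M G] l2norm_nonneg)
    finally show "cmod (\<Sum>q\<in>G. z q * cnj (z q)) \<le> C * l2norm x * l2on G (\<lambda>q. cnj (z q))"
      by (simp add: mult_ac)
  qed (use M bdd_by_nonneg l2norm_nonneg in auto)
  from ell2_if_l2on_le[OF this] show "ell2 (\<lambda>q. \<Sum>\<^sub>\<infinity>p. x p * M p q)"
      "l2norm (\<lambda>q. \<Sum>\<^sub>\<infinity>p. x p * M p q) \<le> C * l2norm x"
    unfolding z_def by blast+
qed

lemma l2norm_tail_tendsto_0:
  assumes "ell2 x"
  shows "((\<lambda>F. l2norm (\<lambda>k. if k \<in> F then 0 else x k)) \<longlongrightarrow> 0) (finite_subsets_at_top UNIV)"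
proof -
  let ?S = "\<Sum>\<^sub>\<infinity>k. (cmod (x k))\<^sup>2"
  have "((\<lambda>F. sqrt (?S - (\<Sum>k\<in>F. (cmod (x k))\<^sup>2))) \<longlongrightarrow> sqrt (?S - ?S)) (finite_subsets_at_top UNIV)"
    using assms unfolding ell2_def by (intro tendsto_intros infsum_tendsto)
  moreover have "sqrt (?S - (\<Sum>k\<in>F. (cmod (x k))\<^sup>2)) = l2norm (\<lambda>k. if k \<in> F then 0 else x k)"
    if F: "finite F" for F
  proof -
    have "?S = (\<Sum>k\<in>F. (cmod (x k))\<^sup>2) + (\<Sum>\<^sub>\<infinity>k\<in>-F. (cmod (x k))\<^sup>2)"
      using infsum_Un_disjoint[of "\<lambda>k. (cmod (x k))\<^sup>2" F "-F"] assms F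
      by (auto simp: ell2_def intro: summable_on_subset_banach)
    moreover have "(\<Sum>\<^sub>\<infinity>k\<in>-F. (cmod (x k))\<^sup>2) = (\<Sum>\<^sub>\<infinity>k. (cmod (if k \<in> F then 0 else x k))\<^sup>2)"
      by (rule infsum_cong_neutral) auto
    ultimately show ?thesis
      by (simp add: l2norm_def)
  qed
  ultimately show ?thesis
    by (auto intro: Lim_transform_eventually eventually_finite_subsets_at_top_weakI)
qed

text \<open>The double series need not converge absolutely, so this is not an instance of Fubini; the
  error of truncating \<open>x\<close> is controlled by the boundedness of \<open>M\<close>.\<close>

lemma bdd_by_infsum_swap:
  assumes M: "bdd_by C M" and x: "ell2 x" and y: "ell2 y"
  shows "(\<Sum>\<^sub>\<infinity>p. x p * (\<Sum>\<^sub>\<infinity>q. M p q * y q)) = (\<Sum>\<^sub>\<infinity>q. (\<Sum>\<^sub>\<infinity>p. x p * M p q) * y q)"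
proof -
  let ?My = "\<lambda>p. \<Sum>\<^sub>\<infinity>q. M p q * y q" and ?xM = "\<lambda>q. \<Sum>\<^sub>\<infinity>p. x p * M p q"
  let ?t = "\<lambda>F k. if k \<in> F then 0 else x k"
  have My: "ell2 ?My"
    using bdd_by_infinite_row(1)[OF bdd_by_transpose[OF M] y] by (simp add: mult_ac)
  have row: "ell2 (M p)" and col: "ell2 (\<lambda>p. M p q)" for p q
    using M bdd_by_row bdd_by_col by blast+
  have t: "ell2 (?t F)" for F
    using x unfolding ell2_def
    by (rule summable_on_comparison_test) auto
  \<comment> \<open>The part of the form missed by truncating \<open>x\<close> to \<open>F\<close>
    is the form of the tail of \<open>x\<close>, whose norm tends to 0.\<close>
  have eq: "(\<Sum>\<^sub>\<infinity>q. ?xM q * y q) - (\<Sum>p\<in>F. x p * ?My p) = (\<Sum>\<^sub>\<infinity>q. (\<Sum>\<^sub>\<infinity>p. ?t F p * M p q) * y q)"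
    if F: "finite F" for F
  proof -
    have xM: "?xM q = (\<Sum>p\<in>F. x p * M p q) + (\<Sum>\<^sub>\<infinity>p. ?t F p * M p q)" for q
    proof -
      have "?xM q = (\<Sum>p\<in>F. x p * M p q) + (\<Sum>\<^sub>\<infinity>p\<in>-F. x p * M p q)"
        using infsum_Un_disjoint[of "\<lambda>p. x p * M p q" F "-F"] F ell2_mult_summable[OF x col]
        by (auto intro: summable_on_subset_banach)
      moreover have "(\<Sum>\<^sub>\<infinity>p\<in>-F. x p * M p q) = (\<Sum>\<^sub>\<infinity>p. ?t F p * M p q)"
        by (rule infsum_cong_neutral) auto
      ultimately show ?thesis
        by simp
    qed
    have s: "(\<lambda>q. x p * (M p q * y q)) summable_on UNIV" for p
      by (intro summable_on_cmult_right ell2_mult_summable row y)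
    have "(\<Sum>p\<in>F. x p * ?My p) = (\<Sum>p\<in>F. \<Sum>\<^sub>\<infinity>q. x p * (M p q * y q))"
      by (intro sum.cong refl infsum_cmult_right'[symmetric])
    also have "\<dots> = (\<Sum>\<^sub>\<infinity>q. \<Sum>p\<in>F. x p * (M p q * y q))"
      by (rule infsum_sum(1)[symmetric]) (rule s)
    finally have 1: "(\<Sum>p\<in>F. x p * ?My p) = (\<Sum>\<^sub>\<infinity>q. (\<Sum>p\<in>F. x p * M p q) * y q)"
      by (simp add: sum_distrib_right mult.assoc)
    have "(\<Sum>\<^sub>\<infinity>q. ?xM q * y q) = (\<Sum>\<^sub>\<infinity>q. (\<Sum>p\<in>F. x p * M p q) * y q + (\<Sum>\<^sub>\<infinity>p. ?t F p * M p q) * y q)"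
      by (simp only: xM distrib_right)
    also have "\<dots> = (\<Sum>\<^sub>\<infinity>q. (\<Sum>p\<in>F. x p * M p q) * y q) + (\<Sum>\<^sub>\<infinity>q. (\<Sum>\<^sub>\<infinity>p. ?t F p * M p q) * y q)"
      by (intro infsum_add ell2_mult_summable y bdd_by_finite_row(1)[OF M F] bdd_by_infinite_row(1)[OF M t])
    finally show ?thesis
      by (simp add: 1)
  qed
  have "((\<lambda>F. (\<Sum>\<^sub>\<infinity>q. ?xM q * y q) - (\<Sum>p\<in>F. x p * ?My p)) \<longlongrightarrow> 0) (finite_subsets_at_top UNIV)"
  proof (rule tendsto_norm_zero_cancel, rule tendsto_sandwich[OF _ _ tendsto_const])
    show "\<forall>\<^sub>F F in finite_subsets_at_top UNIV. cmod ((\<Sum>\<^sub>\<infinity>q. ?xM q * y q) - (\<Sum>p\<in>F. x p * ?My p))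
        \<le> C * l2norm (?t F) * l2norm y"
    proof (rule eventually_finite_subsets_at_top_weakI)
      fix F :: "int set" assume F: "finite F"
      have "cmod (\<Sum>\<^sub>\<infinity>q. (\<Sum>\<^sub>\<infinity>p. ?t F p * M p q) * y q) \<le> l2norm (\<lambda>q. \<Sum>\<^sub>\<infinity>p. ?t F p * M p q) * l2norm y"
        by (intro ell2_mult_bound y bdd_by_infinite_row(1)[OF M t])
      also have "\<dots> \<le> C * l2norm (?t F) * l2norm y"
        by (intro mult_right_mono bdd_by_infinite_row(2)[OF M t] l2norm_nonneg)
      finally show "cmod ((\<Sum>\<^sub>\<infinity>q. ?xM q * y q) - (\<Sum>p\<in>F. x p * ?My p)) \<le> C * l2norm (?t F) * l2norm y"
        using eq[OF F] by simp
    qed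
    have "((\<lambda>F. C * l2norm (?t F) * l2norm y) \<longlongrightarrow> C * 0 * l2norm y) (finite_subsets_at_top UNIV)"
      by (intro tendsto_intros l2norm_tail_tendsto_0 x)
    then show "((\<lambda>F. C * l2norm (?t F) * l2norm y) \<longlongrightarrow> 0) (finite_subsets_at_top UNIV)"
      by simp
  qed auto
  moreover have "((\<lambda>F. (\<Sum>\<^sub>\<infinity>q. ?xM q * y q) - (\<Sum>p\<in>F. x p * ?My p)) \<longlongrightarrow>
      (\<Sum>\<^sub>\<infinity>q. ?xM q * y q) - (\<Sum>\<^sub>\<infinity>p. x p * ?My p)) (finite_subsets_at_top UNIV)"
    by (intro tendsto_intros infsum_tendsto ell2_mult_summable x My)
  ultimately have "(\<Sum>\<^sub>\<infinity>q. ?xM q * y q) - (\<Sum>\<^sub>\<infinity>p. x p * ?My p) = 0"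
    by (rule tendsto_unique[OF finite_subsets_at_top_neq_bot, rotated])
  then show ?thesis
    by simp
qed

text \<open>At a fixed middle index the form factors into a row combination of \<open>A\<close> and
  a column combination of \<open>B\<close>, whose norms are bounded separately.\<close>

lemma bdd_by_mult:
  assumes A: "bdd_by C A" and B: "bdd_by D B"
  shows "bdd_by (C * D) (\<lambda>p q. \<Sum>\<^sub>\<infinity>k. A p k * B k q)"
  unfolding bdd_by_def
proof (intro conjI allI impI)
  fix F G :: "int set" and x y assume F: "finite F" and G: "finite G"
  have s: "(\<lambda>k. x p * (A p k * B k q) * y q) summable_on UNIV" for p q
    by (intro summable_on_cmult_left summable_on_cmult_right ell2_mult_summable
        bdd_by_row[OF A] bdd_by_col[OF B])
  have "(\<Sum>p\<in>F. \<Sum>q\<in>G. x p * (\<Sum>\<^sub>\<infinity>k. A p k * B k q) * y q)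
      = (\<Sum>p\<in>F. \<Sum>q\<in>G. \<Sum>\<^sub>\<infinity>k. x p * (A p k * B k q) * y q)"
    by (simp only: infsum_cmult_right' infsum_cmult_left')
  also have "\<dots> = (\<Sum>\<^sub>\<infinity>k. \<Sum>p\<in>F. \<Sum>q\<in>G. x p * (A p k * B k q) * y q)"
    by (simp add: infsum_sum s)
  also have "\<dots> = (\<Sum>\<^sub>\<infinity>k. (\<Sum>p\<in>F. x p * A p k) * (\<Sum>q\<in>G. B k q * y q))"
    by (simp add: sum_product mult_ac)
  also have "cmod \<dots> \<le> l2norm (\<lambda>k. \<Sum>p\<in>F. x p * A p k) * l2norm (\<lambda>k. \<Sum>q\<in>G. B k q * y q)"
    by (intro ell2_mult_bound bdd_by_finite_row[OF A F] bdd_by_finite_col[OF B G])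
  also have "\<dots> \<le> (C * l2on F x) * (D * l2on G y)"
    using bdd_by_nonneg[OF A]
    by (intro mult_mono bdd_by_finite_row[OF A F] bdd_by_finite_col[OF B G])
      (auto simp: l2norm_nonneg L2_set_nonneg)
  finally show "cmod (\<Sum>p\<in>F. \<Sum>q\<in>G. x p * (\<Sum>\<^sub>\<infinity>k. A p k * B k q) * y q) \<le> C * D * l2on F x * l2on G y"
    by (simp add: mult_ac)
qed (use bdd_by_nonneg[OF A] bdd_by_nonneg[OF B] in auto)

lemma bdd_by_add:
  assumes A: "bdd_by C A" and B: "bdd_by D B"
  shows "bdd_by (C + D) (\<lambda>p q. A p q + B p q)"
  unfolding bdd_by_def
proof (intro conjI allI impI)
  fix F G :: "int set" and x y assume F: "finite F" and G: "finite G"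
  have "(\<Sum>p\<in>F. \<Sum>q\<in>G. x p * (A p q + B p q) * y q)
      = (\<Sum>p\<in>F. \<Sum>q\<in>G. x p * A p q * y q) + (\<Sum>p\<in>F. \<Sum>q\<in>G. x p * B p q * y q)"
    by (simp add: algebra_simps sum.distrib)
  then show "cmod (\<Sum>p\<in>F. \<Sum>q\<in>G. x p * (A p q + B p q) * y q) \<le> (C + D) * l2on F x * l2on G y"
    using bdd_byD[OF A F G, of x y] bdd_byD[OF B F G, of x y]
    by (simp add: norm_triangle_le algebra_simps)
qed (use bdd_by_nonneg[OF A] bdd_by_nonneg[OF B] in auto)

lemma bdd_by_cmult:
  assumes A: "bdd_by C A"
  shows "bdd_by (cmod a * C) (\<lambda>p q. a * A p q)"
  unfolding bdd_by_def
proof (intro conjI allI impI)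
  fix F G :: "int set" and x y assume F: "finite F" and G: "finite G"
  have "(\<Sum>p\<in>F. \<Sum>q\<in>G. x p * (a * A p q) * y q) = a * (\<Sum>p\<in>F. \<Sum>q\<in>G. x p * A p q * y q)"
    by (simp add: sum_distrib_left mult_ac)
  then show "cmod (\<Sum>p\<in>F. \<Sum>q\<in>G. x p * (a * A p q) * y q) \<le> cmod a * C * l2on F x * l2on G y"
    using mult_left_mono[OF bdd_byD[OF A F G, of x y], of "cmod a"] by (simp add: norm_mult mult_ac)
qed (use bdd_by_nonneg[OF A] in auto)

text \<open>A matrix supported on one shifted diagonal pairs \<open>x\<close> at \<open>p\<close>
  with \<open>y\<close> at \<open>p - s\<close> only. Such matrices are the building blocks of the
  finitely supported elements of the crossed product.\<close>

lemma bdd_by_diagonal: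
  assumes K: "\<And>p. cmod (d p) \<le> K"
  shows "bdd_by K (\<lambda>p q. if p - q = s then d p else 0)"
  unfolding bdd_by_def
proof (intro conjI allI impI)
  show K0: "0 \<le> K"
    using K[of 0] norm_ge_zero order_trans by blast
  fix F G :: "int set" and x y :: "int \<Rightarrow> complex" assume F: "finite F" and G: "finite G"
  \<comment> \<open>\<open>H\<close> collects the rows in \<open>F\<close> whose only possible
    nonzero entry lies in a column of \<open>G\<close>.\<close>
  define H where "H = {p\<in>F. p - s \<in> G}"
  have H: "finite H" "H \<subseteq> F" "(\<lambda>p. p - s) ` H \<subseteq> G"
    using F by (auto simp: H_def)
  have "(\<Sum>q\<in>G. x p * (if p - q = s then d p else 0) * y q) = (if p - s \<in> G then x p * d p * y (p - s) else 0)" for p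
  proof -
    have "(\<Sum>q\<in>G. x p * (if p - q = s then d p else 0) * y q) = (\<Sum>q\<in>G. if q = p - s then x p * d p * y q else 0)"
      by (intro sum.cong) auto
    then show ?thesis using G by simp
  qed
  then have "(\<Sum>p\<in>F. \<Sum>q\<in>G. x p * (if p - q = s then d p else 0) * y q) = (\<Sum>p\<in>H. x p * d p * y (p - s))"
    unfolding H_def by (simp add: sum.inter_filter[OF F])
  also have "cmod \<dots> \<le> (\<Sum>p\<in>H. cmod (x p * d p * y (p - s)))"
    by (rule norm_sum)
  also have "\<dots> \<le> (\<Sum>p\<in>H. K * (cmod (x p) * cmod (y (p - s))))"
    by (intro sum_mono) (auto simp: norm_mult mult_ac intro!: mult_right_mono K)
  also have "\<dots> \<le> K * (l2on H x * l2on H (\<lambda>p. y (p - s)))"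
    unfolding sum_distrib_left[symmetric]
    using L2_set_mult_ineq[of "\<lambda>p. cmod (x p)" "\<lambda>p. cmod (y (p - s))" H]
    by (intro mult_left_mono K0) simp
  also have "\<dots> \<le> K * (l2on F x * l2on G y)"
  proof (intro mult_left_mono mult_mono K0)
    have "(\<Sum>p\<in>H. (cmod (y (p - s)))\<^sup>2) = (\<Sum>q\<in>(\<lambda>p. p - s) ` H. (cmod (y q))\<^sup>2)"
      by (subst sum.reindex) (auto simp: inj_on_def)
    also have "\<dots> \<le> (\<Sum>q\<in>G. (cmod (y q))\<^sup>2)"
      by (intro sum_mono2 G H) auto
    finally show "l2on H (\<lambda>p. y (p - s)) \<le> l2on G y"
      by (simp add: L2_set_def)
    show "l2on H x \<le> l2on F x"
      unfolding L2_set_def by (intro real_sqrt_le_mono sum_mono2 F H) auto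
  qed (auto simp: L2_set_nonneg)
  finally show "cmod (\<Sum>p\<in>F. \<Sum>q\<in>G. x p * (if p - q = s then d p else 0) * y q) \<le> K * l2on F x * l2on G y"
    by (simp add: mult_ac)
qed

definition bdd_mat :: "(int \<Rightarrow> int \<Rightarrow> complex) \<Rightarrow> bool" where
  "bdd_mat M \<longleftrightarrow> (\<exists>C. bdd_by C M)"

lemma bdd_matI: "bdd_by C M \<Longrightarrow> bdd_mat M"
  by (auto simp: bdd_mat_def)

lemma bdd_mat_zero: "bdd_mat (\<lambda>p q. 0)"
  by (rule bdd_matI[of 0]) (simp add: bdd_by_def)

lemma bdd_mat_add: "bdd_mat A \<Longrightarrow> bdd_mat B \<Longrightarrow> bdd_mat (\<lambda>p q. A p q + B p q)"
  unfolding bdd_mat_def using bdd_by_add by blast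

lemma bdd_mat_cmult: "bdd_mat A \<Longrightarrow> bdd_mat (\<lambda>p q. a * A p q)"
  unfolding bdd_mat_def using bdd_by_cmult by blast

lemma bdd_mat_minus: "bdd_mat A \<Longrightarrow> bdd_mat (\<lambda>p q. - A p q)"
  using bdd_mat_cmult[of A "-1"] by simp

lemma bdd_mat_diff: "bdd_mat A \<Longrightarrow> bdd_mat B \<Longrightarrow> bdd_mat (\<lambda>p q. A p q - B p q)"
  using bdd_mat_add[OF _ bdd_mat_minus, of A B] by simp

lemma bdd_mat_sum: "(\<And>s. s \<in> S \<Longrightarrow> bdd_mat (A s)) \<Longrightarrow> bdd_mat (\<lambda>p q. \<Sum>s\<in>S. A s p q)"
  by (induction S rule: infinite_finite_induct) (auto intro: bdd_mat_zero bdd_mat_add)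

lemma bdd_mat_mult: "bdd_mat A \<Longrightarrow> bdd_mat B \<Longrightarrow> bdd_mat (\<lambda>p q. \<Sum>\<^sub>\<infinity>k. A p k * B k q)"
  unfolding bdd_mat_def using bdd_by_mult by blast

lemma bdd_mat_adj: "bdd_mat A \<Longrightarrow> bdd_mat (\<lambda>p q. cnj (A q p))"
  unfolding bdd_mat_def using bdd_by_cnj[OF bdd_by_transpose[of _ A]] by blast

lemma bdd_mat_row: "bdd_mat A \<Longrightarrow> ell2 (A p)"
  unfolding bdd_mat_def using bdd_by_row by blast

lemma bdd_mat_col: "bdd_mat A \<Longrightarrow> ell2 (\<lambda>p. A p q)"
  unfolding bdd_mat_def using bdd_by_col by blast

lemma bdd_mat_one: "bdd_mat (\<lambda>p q. if p = q then 1 else 0)"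
  using bdd_by_diagonal[of "\<lambda>_. 1" 1 0] by (auto intro: bdd_matI)

lemma bdd_mat_assoc:
  assumes "bdd_mat A" "bdd_mat B" "bdd_mat C"
  shows "(\<Sum>\<^sub>\<infinity>k. (\<Sum>\<^sub>\<infinity>l. A p l * B l k) * C k q) = (\<Sum>\<^sub>\<infinity>l. A p l * (\<Sum>\<^sub>\<infinity>k. B l k * C k q))"
  using assms bdd_by_infsum_swap[OF _ bdd_mat_row bdd_mat_col, of _ B A C p q]
  by (auto simp: bdd_mat_def)

text \<open>This is the C*-identity: the squared norm of a finite row combination is the Gram form
  at its coefficients, so a bound \<open>C\<close> for the Gram matrix gives \<open>sqrt C\<close>
  for \<open>A\<close>. The bimodule norm controls only the Gram matrix, hence this route to
  boundedness.\<close>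

lemma bdd_mat_if_gram:
  assumes row: "\<And>p. ell2 (A p)" and gram: "bdd_mat (\<lambda>p q. \<Sum>\<^sub>\<infinity>k. A p k * cnj (A q k))"
  shows "bdd_mat A"
proof -
  obtain C where C: "bdd_by C (\<lambda>p q. \<Sum>\<^sub>\<infinity>k. A p k * cnj (A q k))"
    using gram by (auto simp: bdd_mat_def)
  have row_bound: "l2on G (\<lambda>k. \<Sum>p\<in>F. x p * A p k) \<le> sqrt C * l2on F x"
    if F: "finite F" and G: "finite G" for F G x
  proof -
    define z where "z k = (\<Sum>p\<in>F. x p * A p k)" for k
    have z: "ell2 z"
      unfolding z_def[abs_def]
      using F by (induction F rule: finite_induct) (auto simp: ell2_add ell2_cmult row ell2_finite)
    have s: "(\<lambda>k. x p * (A p k * cnj (A q k)) * cnj (x q)) summable_on UNIV" for p q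
      by (intro summable_on_cmult_left summable_on_cmult_right ell2_mult_summable) (simp_all add: row)
    have "of_real (\<Sum>\<^sub>\<infinity>k. (cmod (z k))\<^sup>2) = (\<Sum>\<^sub>\<infinity>k. of_real ((cmod (z k))\<^sup>2) :: complex)"
      using z by (intro infsumI[symmetric] has_sum_of_real) (auto simp: ell2_def)
    also have "\<dots> = (\<Sum>\<^sub>\<infinity>k. \<Sum>p\<in>F. \<Sum>q\<in>F. x p * (A p k * cnj (A q k)) * cnj (x q))"
      by (simp add: complex_norm_square z_def sum_product mult_ac del: of_real_power)
    also have "\<dots> = (\<Sum>p\<in>F. \<Sum>q\<in>F. x p * (\<Sum>\<^sub>\<infinity>k. A p k * cnj (A q k)) * cnj (x q))"
      by (simp add: infsum_sum s infsum_cmult_right' infsum_cmult_left')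
    finally have "of_real (\<Sum>\<^sub>\<infinity>k. (cmod (z k))\<^sup>2) = \<dots>" .
    then have "cmod (of_real (\<Sum>\<^sub>\<infinity>k. (cmod (z k))\<^sup>2)) \<le> C * l2on F x * l2on F (\<lambda>q. cnj (x q))"
      using bdd_byD[OF C F F, of x "\<lambda>q. cnj (x q)"] by simp
    then have "(\<Sum>\<^sub>\<infinity>k. (cmod (z k))\<^sup>2) \<le> C * (l2on F x)\<^sup>2"
      by (simp add: power2_eq_square mult_ac)
    then have "l2norm z \<le> sqrt (C * (l2on F x)\<^sup>2)"
      unfolding l2norm_def by (rule real_sqrt_le_mono)
    also have "\<dots> = sqrt C * l2on F x"
      by (simp add: real_sqrt_mult L2_set_nonneg)
    finally show ?thesis
      using l2on_le_l2norm[OF z G] by (simp add: z_def)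
  qed
  have "bdd_by (sqrt C) A"
    unfolding bdd_by_def
  proof (intro conjI allI impI)
    fix F G :: "int set" and x y assume F: "finite F" and G: "finite G"
    have "(\<Sum>p\<in>F. \<Sum>q\<in>G. x p * A p q * y q) = (\<Sum>q\<in>G. (\<Sum>p\<in>F. x p * A p q) * y q)"
      by (subst sum.swap) (simp add: sum_distrib_right)
    also have "cmod \<dots> \<le> (\<Sum>q\<in>G. cmod (\<Sum>p\<in>F. x p * A p q) * cmod (y q))"
      using norm_sum by (simp add: norm_mult[symmetric])
    also have "\<dots> \<le> l2on G (\<lambda>q. \<Sum>p\<in>F. x p * A p q) * l2on G y"
      using L2_set_mult_ineq[of "\<lambda>q. cmod (\<Sum>p\<in>F. x p * A p q)" "\<lambda>q. cmod (y q)" G] by simp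
    also have "\<dots> \<le> sqrt C * l2on F x * l2on G y"
      by (intro mult_right_mono row_bound F G) (simp add: L2_set_nonneg)
    finally show "cmod (\<Sum>p\<in>F. \<Sum>q\<in>G. x p * A p q * y q) \<le> sqrt C * l2on F x * l2on G y" .
  qed (use bdd_by_nonneg[OF C] in auto)
  then show ?thesis
    by (rule bdd_matI)
qed

section \<open>The ring of bounded matrices and its adjoint\<close>

typedef bmat = "{M. bdd_mat M}" morphisms entry Bmat
  using bdd_mat_zero by blast

lemma bdd_mat_entry: "bdd_mat (entry A)"
  using entry by blast

lemma entry_Bmat: "bdd_mat M \<Longrightarrow> entry (Bmat M) = M"
  by (simp add: Bmat_inverse)

lemma bmat_eqI: "(\<And>p q. entry A p q = entry B p q) \<Longrightarrow> A = B"
  by (metis entry_inject ext)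

text \<open>With a ring structure on the type, questions of convergence are settled here once, and
  the later operator identities become ring rewriting.\<close>

instantiation bmat :: ring_1
begin

definition "0 = Bmat (\<lambda>p q. 0)"
definition "1 = Bmat (\<lambda>p q. if p = q then 1 else 0)"
definition "A + B = Bmat (\<lambda>p q. entry A p q + entry B p q)"
definition "- A = Bmat (\<lambda>p q. - entry A p q)"
definition "A - B = Bmat (\<lambda>p q. entry A p q - entry B p q)"
definition "A * B = Bmat (\<lambda>p q. \<Sum>\<^sub>\<infinity>k. entry A p k * entry B k q)"

lemma entry_simps:
  "entry 0 p q = 0"
  "entry 1 p q = (if p = q then 1 else 0)"
  "entry (A + B) p q = entry A p q + entry B p q"
  "entry (- A) p q = - entry A p q"
  "entry (A - B) p q = entry A p q - entry B p q"
  "entry (A * B) p q = (\<Sum>\<^sub>\<infinity>k. entry A p k * entry B k q)"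
  unfolding zero_bmat_def one_bmat_def plus_bmat_def uminus_bmat_def minus_bmat_def times_bmat_def
  by (simp_all add: entry_Bmat bdd_mat_entry bdd_mat_zero bdd_mat_one bdd_mat_add bdd_mat_minus
      bdd_mat_diff bdd_mat_mult)

lemma entry_mult_summable: "(\<lambda>k. entry A p k * entry B k q) summable_on UNIV"
  by (intro ell2_mult_summable bdd_mat_row bdd_mat_col bdd_mat_entry)

instance
proof
  fix A B C :: bmat
  show "A * B * C = A * (B * C)"
    by (rule bmat_eqI) (simp add: entry_simps bdd_mat_assoc bdd_mat_entry)
  show "1 * A = A"
  proof (rule bmat_eqI)
    fix p q
    have "(\<Sum>\<^sub>\<infinity>k. (if p = k then 1 else 0) * entry A k q) = (\<Sum>\<^sub>\<infinity>k\<in>{p}. entry A k q)"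
      by (rule infsum_cong_neutral) auto
    then show "entry (1 * A) p q = entry A p q"
      by (simp add: entry_simps)
  qed
  show "A * 1 = A"
  proof (rule bmat_eqI)
    fix p q
    have "(\<Sum>\<^sub>\<infinity>k. entry A p k * (if k = q then 1 else 0)) = (\<Sum>\<^sub>\<infinity>k\<in>{q}. entry A p k)"
      by (rule infsum_cong_neutral) auto
    then show "entry (A * 1) p q = entry A p q"
      by (simp add: entry_simps)
  qed
  show "(A + B) * C = A * C + B * C"
    by (rule bmat_eqI) (simp add: entry_simps distrib_right infsum_add entry_mult_summable)
  show "A * (B + C) = A * B + A * C"
    by (rule bmat_eqI) (simp add: entry_simps distrib_left infsum_add entry_mult_summable)
  have "entry (0::bmat) 0 0 \<noteq> entry 1 0 0"
    by (simp add: entry_simps)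
  then show "(0::bmat) \<noteq> 1"
    by metis
qed (auto intro!: bmat_eqI simp: entry_simps)

end

definition adj :: "bmat \<Rightarrow> bmat" where
  "adj A = Bmat (\<lambda>p q. cnj (entry A q p))"

lemma entry_adj [simp]: "entry (adj A) p q = cnj (entry A q p)"
  by (simp add: adj_def entry_Bmat bdd_mat_adj bdd_mat_entry)

lemma adj_simps:
  "adj (adj A) = A" "adj (A + B) = adj A + adj B" "adj (A - B) = adj A - adj B" "adj (- A) = - adj A"
  "adj (A * B) = adj B * adj A" "adj 1 = 1"
  by (auto intro!: bmat_eqI simp: entry_simps mult.commute simp flip: infsum_cnj)

section \<open>Norm and coefficients in the crossed products\<close>

lemma ee_0 [simp]: "ee 0 = 1"
  by (simp add: ee_def)

lemma ee_add: "ee (s + t) = ee s * ee t"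
  by (simp add: ee_def distrib_left exp_add)

lemma cnj_ee: "cnj (ee t) = ee (- t)"
  by (simp add: ee_def exp_cnj)

lemma norm_ee [simp]: "cmod (ee t) = 1"
  by (simp add: ee_def)

text \<open>The part of the group law that makes any \<open>m\<close> the point at position
  \<open>p\<close> of an orbit, namely that of \<open>\<alpha> (- p) m\<close>.\<close>

definition zaction_inv :: "zaction \<Rightarrow> bool" where
  "zaction_inv \<alpha> \<longleftrightarrow> (\<forall>p m. \<alpha> p (\<alpha> (- p) m) = m)"

lemma zaction_inv_lam: "zaction_inv (lam \<mu> \<nu>)"
  by (auto simp: zaction_inv_def lam_def)

lemma zaction_inv_sig: "zaction_inv sig"
  by (auto simp: zaction_inv_def sig_def)

text \<open>The image of \<Phi> in the regular representation at \<open>m\<close>; its action on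
  finitely supported vectors is \<open>cp_regular\<close>.\<close>

definition reg_mat :: "zaction \<Rightarrow> cpfun \<Rightarrow> real \<times> real \<Rightarrow> int \<Rightarrow> int \<Rightarrow> complex" where
  "reg_mat \<alpha> \<Phi> m p q = \<Phi> (\<alpha> p m) (p - q)"

definition reg_bound :: "zaction \<Rightarrow> cpfun \<Rightarrow> real \<Rightarrow> bool" where
  "reg_bound \<alpha> \<Phi> C \<longleftrightarrow> 0 \<le> C \<and>
     (\<forall>m \<xi>. finite {q. \<xi> q \<noteq> 0} \<longrightarrow>
        (\<Sum>\<^sub>\<infinity>p. ennreal ((cmod (cp_regular \<alpha> \<Phi> m \<xi> p))\<^sup>2))
          \<le> ennreal (C\<^sup>2 * (\<Sum>q | \<xi> q \<noteq> 0. (cmod (\<xi> q))\<^sup>2)))"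

lemma cp_norm_alt: "cp_norm \<alpha> \<Phi> = Inf (ennreal ` {C. reg_bound \<alpha> \<Phi> C})"
  by (simp add: cp_norm_def reg_bound_def)

text \<open>The operator bound controls the norm of the image of a finite vector, and pairing that
  image with \<open>x\<close> by Cauchy-Schwarz yields the bilinear bound.\<close>

lemma reg_bound_bdd_by:
  assumes "reg_bound \<alpha> \<Phi> C"
  shows "bdd_by C (reg_mat \<alpha> \<Phi> m)"
  unfolding bdd_by_def
proof (intro conjI allI impI)
  show C: "0 \<le> C"
    using assms by (simp add: reg_bound_def)
  fix F G :: "int set" and x y :: "int \<Rightarrow> complex" assume F: "finite F" and G: "finite G"
  let ?M = "reg_mat \<alpha> \<Phi> m"
  \<comment> \<open>Extending \<open>y\<close> by zero outside \<open>G\<close> gives a finitely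
    supported vector on which \<open>cp_regular\<close> can be tested.\<close>
  define \<xi> where "\<xi> q = (if q \<in> G then y q else 0)" for q
  have supp: "{q. \<xi> q \<noteq> 0} \<subseteq> G"
    by (auto simp: \<xi>_def)
  then have fin: "finite {q. \<xi> q \<noteq> 0}"
    using G finite_subset by blast
  have reg: "cp_regular \<alpha> \<Phi> m \<xi> p = (\<Sum>q\<in>G. ?M p q * y q)" for p
  proof -
    have "cp_regular \<alpha> \<Phi> m \<xi> p = (\<Sum>q\<in>G. ?M p q * \<xi> q)"
      unfolding cp_regular_def reg_mat_def by (rule sum.mono_neutral_left[OF G supp]) auto
    then show ?thesis by (simp add: \<xi>_def)
  qed
  have nrm: "(\<Sum>q | \<xi> q \<noteq> 0. (cmod (\<xi> q))\<^sup>2) = (\<Sum>q\<in>G. (cmod (y q))\<^sup>2)"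
  proof -
    have "(\<Sum>q | \<xi> q \<noteq> 0. (cmod (\<xi> q))\<^sup>2) = (\<Sum>q\<in>G. (cmod (\<xi> q))\<^sup>2)"
      by (rule sum.mono_neutral_left[OF G supp]) auto
    then show ?thesis by (simp add: \<xi>_def)
  qed
  have "ennreal (\<Sum>p\<in>F. (cmod (\<Sum>q\<in>G. ?M p q * y q))\<^sup>2) = (\<Sum>p\<in>F. ennreal ((cmod (cp_regular \<alpha> \<Phi> m \<xi> p))\<^sup>2))"
    by (simp add: reg)
  also have "\<dots> \<le> (\<Sum>\<^sub>\<infinity>p. ennreal ((cmod (cp_regular \<alpha> \<Phi> m \<xi> p))\<^sup>2))"
    using F by (subst nonneg_infsum_complete) (auto intro!: SUP_upper)
  also have "\<dots> \<le> ennreal (C\<^sup>2 * (\<Sum>q\<in>G. (cmod (y q))\<^sup>2))"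
    using assms fin unfolding reg_bound_def nrm[symmetric] by blast
  finally have "(\<Sum>p\<in>F. (cmod (\<Sum>q\<in>G. ?M p q * y q))\<^sup>2) \<le> C\<^sup>2 * (\<Sum>q\<in>G. (cmod (y q))\<^sup>2)"
    by (subst (asm) ennreal_le_iff) (simp_all add: sum_nonneg)
  then have "l2on F (\<lambda>p. \<Sum>q\<in>G. ?M p q * y q) \<le> sqrt (C\<^sup>2 * (\<Sum>q\<in>G. (cmod (y q))\<^sup>2))"
    unfolding L2_set_def by (rule real_sqrt_le_mono)
  also have "\<dots> = C * l2on G y"
    using C by (simp add: real_sqrt_mult L2_set_def)
  finally have *: "l2on F (\<lambda>p. \<Sum>q\<in>G. ?M p q * y q) \<le> C * l2on G y" .
  have "(\<Sum>p\<in>F. \<Sum>q\<in>G. x p * ?M p q * y q) = (\<Sum>p\<in>F. x p * (\<Sum>q\<in>G. ?M p q * y q))"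
    by (simp add: sum_distrib_left mult.assoc)
  also have "cmod \<dots> \<le> (\<Sum>p\<in>F. cmod (x p) * cmod (\<Sum>q\<in>G. ?M p q * y q))"
    using norm_sum by (simp add: norm_mult[symmetric])
  also have "\<dots> \<le> l2on F x * l2on F (\<lambda>p. \<Sum>q\<in>G. ?M p q * y q)"
    using L2_set_mult_ineq[of "\<lambda>q. cmod (x q)" "\<lambda>p. cmod (\<Sum>q\<in>G. ?M p q * y q)" F] by simp
  also have "\<dots> \<le> l2on F x * (C * l2on G y)"
    by (intro mult_left_mono *) (simp add: L2_set_nonneg)
  finally show "cmod (\<Sum>p\<in>F. \<Sum>q\<in>G. x p * ?M p q * y q) \<le> C * l2on F x * l2on G y"
    by (simp add: mult_ac)
qed

lemma cp_norm_finite_bdd_mat: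
  assumes "cp_norm \<alpha> \<Phi> < top"
  shows "bdd_mat (reg_mat \<alpha> \<Phi> m)"
proof -
  obtain C where "reg_bound \<alpha> \<Phi> C"
    using assms unfolding cp_norm_alt by (auto simp: Inf_less_iff)
  then show ?thesis
    by (rule bdd_matI[OF reg_bound_bdd_by])
qed

text \<open>The coefficient is the entry at \<open>p\<close>, 0 of the matrix based at
  \<open>\<alpha> (- p) m\<close>, and an entry never exceeds the operator norm.\<close>

lemma coeff_le_cp_norm:
  assumes "zaction_inv \<alpha>"
  shows "ennreal (cmod (\<Phi> m p)) \<le> cp_norm \<alpha> \<Phi>"
  unfolding cp_norm_alt
proof (rule Inf_greatest, safe)
  fix C assume "reg_bound \<alpha> \<Phi> C"
  from bdd_byD[OF reg_bound_bdd_by[OF this, of "\<alpha> (- p) m"], of "{p}" "{0}" "\<lambda>_. 1" "\<lambda>_. 1"]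
  show "ennreal (cmod (\<Phi> m p)) \<le> ennreal C"
    using assms by (intro ennreal_leI) (simp add: reg_mat_def zaction_inv_def del: split_paired_All)
qed

lemma cp_norm_tendsto_0_coeff:
  assumes "zaction_inv \<alpha>" and "((\<lambda>t. cp_norm \<alpha> (H t)) \<longlongrightarrow> 0) F" and "0 < e"
  shows "\<forall>\<^sub>F t in F. \<forall>m p. cmod (H t m p) < e"
proof -
  have "\<forall>\<^sub>F t in F. cp_norm \<alpha> (H t) < ennreal e"
    using assms(2,3) by (intro order_tendstoD(2)) auto
  then show ?thesis
  proof eventually_elim
    case (elim t)
    have "ennreal (cmod (H t m p)) < ennreal e" for m p
      using coeff_le_cp_norm[OF assms(1)] elim by (rule le_less_trans)
    then show ?case
      using ennreal_less_iff norm_ge_zero by blast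
  qed
qed

lemma cp_norm_tendsto_0_coeff_tendsto:
  assumes "zaction_inv \<alpha>" and "((\<lambda>t. cp_norm \<alpha> (H t)) \<longlongrightarrow> 0) F"
  shows "((\<lambda>t. H t m p) \<longlongrightarrow> 0) F"
proof (rule tendstoI)
  fix e :: real assume "0 < e"
  from cp_norm_tendsto_0_coeff[OF assms this] show "\<forall>\<^sub>F t in F. dist (H t m p) 0 < e"
    by eventually_elim (simp add: dist_norm del: split_paired_All)
qed

section \<open>Properties inherited by the norm closures\<close>

lemma cp_closure_uniform_limit:
  assumes "zaction_inv \<alpha>" and "(\<lambda>n. cp_norm \<alpha> (\<Phi> - F n)) \<longlonglongrightarrow> 0"
  shows "uniform_limit UNIV (\<lambda>n m. F n m p) (\<lambda>m. \<Phi> m p) sequentially"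
proof (rule uniform_limitI)
  fix e :: real assume "0 < e"
  from cp_norm_tendsto_0_coeff[OF assms this]
  show "\<forall>\<^sub>F n in sequentially. \<forall>m\<in>UNIV. dist (F n m p) (\<Phi> m p) < e"
    by eventually_elim (simp add: dist_norm norm_minus_commute)
qed

lemma cp_closure_tendsto:
  assumes "zaction_inv \<alpha>" and "(\<lambda>n. cp_norm \<alpha> (\<Phi> - F n)) \<longlonglongrightarrow> 0"
  shows "(\<lambda>n. F n m p) \<longlonglongrightarrow> \<Phi> m p"
  using tendsto_uniform_limitI[OF cp_closure_uniform_limit[OF assms]] by simp

text \<open>Norm convergence implies uniform convergence of each coefficient, so continuity survives
  the limit.\<close>

lemma cp_closure_continuous:
  assumes "zaction_inv \<alpha>" and "S \<subseteq> cp_core" and "\<Phi> \<in> cp_closure \<alpha> S"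
  shows "continuous_on UNIV (\<lambda>m. \<Phi> m p)"
proof -
  obtain F where F: "\<And>n. F n \<in> S" "(\<lambda>n. cp_norm \<alpha> (\<Phi> - F n)) \<longlonglongrightarrow> 0"
    using assms(3) by (auto simp: cp_closure_def)
  have "continuous_on UNIV (\<lambda>m. F n m p)" for n
    using F(1)[of n] assms(2) by (auto simp: cp_core_def)
  then show ?thesis
    by (intro uniform_limit_theorem[OF _ cp_closure_uniform_limit[OF assms(1) F(2)]] always_eventually) auto
qed

text \<open>A finitely supported element is a finite sum of shifted diagonals, one for each
  \<open>s\<close> in its support, each with bounded entries.\<close>

lemma cp_core_bdd_mat:
  assumes "\<Phi> \<in> cp_core"
  shows "bdd_mat (reg_mat \<alpha> \<Phi> m)"
proof -
  define S where "S = {p. \<exists>m. \<Phi> m p \<noteq> 0}"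
  have S: "finite S" and bdd: "bounded (range (\<lambda>m. \<Phi> m s))" for s
    using assms by (auto simp: cp_core_def S_def)
  have "bdd_mat (\<lambda>p q. if p - q = s then \<Phi> (\<alpha> p m) s else 0)" for s
  proof -
    obtain K where "\<And>m. cmod (\<Phi> m s) \<le> K"
      using bdd[of s] by (auto simp: bounded_iff)
    then show ?thesis
      by (intro bdd_matI[OF bdd_by_diagonal])
  qed
  then have "bdd_mat (\<lambda>p q. \<Sum>s\<in>S. if p - q = s then \<Phi> (\<alpha> p m) s else 0)"
    by (intro bdd_mat_sum)
  moreover have "(\<lambda>p q. \<Sum>s\<in>S. if p - q = s then \<Phi> (\<alpha> p m) s else 0) = reg_mat \<alpha> \<Phi> m"
    using S by (auto simp: fun_eq_iff reg_mat_def S_def simp del: split_paired_All split_paired_Ex)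
  ultimately show ?thesis
    by simp
qed

text \<open>One approximant at finite distance suffices: the difference is bounded by its finite
  norm, the approximant by its finite support.\<close>

lemma cp_closure_bdd_mat:
  assumes "S \<subseteq> cp_core" and "\<Phi> \<in> cp_closure \<alpha> S"
  shows "bdd_mat (reg_mat \<alpha> \<Phi> m)"
proof -
  obtain F where F: "\<And>n. F n \<in> S" "(\<lambda>n. cp_norm \<alpha> (\<Phi> - F n)) \<longlonglongrightarrow> 0"
    using assms(2) by (auto simp: cp_closure_def)
  have "\<forall>\<^sub>F n in sequentially. cp_norm \<alpha> (\<Phi> - F n) < top"
    using F(2) by (rule order_tendstoD) simp
  then obtain n where "cp_norm \<alpha> (\<Phi> - F n) < top"
    by (auto dest: eventually_happens)
  then have "bdd_mat (\<lambda>p q. reg_mat \<alpha> (\<Phi> - F n) m p q + reg_mat \<alpha> (F n) m p q)"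
    using F(1) assms(1) by (intro bdd_mat_add cp_norm_finite_bdd_mat cp_core_bdd_mat) auto
  then show ?thesis
    by (simp add: reg_mat_def[abs_def])
qed

lemma D_alg_continuous: "\<Phi> \<in> D_alg c \<mu> \<nu> \<Longrightarrow> continuous_on UNIV (\<lambda>m. \<Phi> m p)"
  unfolding D_alg_def by (rule cp_closure_continuous[OF zaction_inv_lam]) (auto simp: D0_def)

lemma E_alg_continuous: "\<Psi> \<in> E_alg c \<mu> \<nu> \<Longrightarrow> continuous_on UNIV (\<lambda>m. \<Psi> m p)"
  unfolding E_alg_def by (rule cp_closure_continuous[OF zaction_inv_sig]) (auto simp: E0_def)

lemma D_alg_bdd_mat: "\<Phi> \<in> D_alg c \<mu> \<nu> \<Longrightarrow> bdd_mat (reg_mat (lam \<mu> \<nu>) \<Phi> m)"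
  unfolding D_alg_def by (rule cp_closure_bdd_mat) (auto simp: D0_def)

lemma D_alg_periodic:
  assumes "\<Phi> \<in> D_alg c \<mu> \<nu>"
  shows "\<Phi> (x, y + 1) p = \<Phi> (x, y) p"
proof -
  obtain F where F: "\<And>n. F n \<in> D0 c \<nu>" "(\<lambda>n. cp_norm (lam \<mu> \<nu>) (\<Phi> - F n)) \<longlonglongrightarrow> 0"
    using assms by (auto simp: D_alg_def cp_closure_def)
  have "F n (x, y + 1) p = F n (x, y) p" for n
    using F(1)[of n] by (auto simp: D0_def cp_core_def periodicM_def)
  then show ?thesis
    using cp_closure_tendsto[OF zaction_inv_lam F(2), of "(x, y + 1)" p]
      cp_closure_tendsto[OF zaction_inv_lam F(2), of "(x, y)" p] LIMSEQ_unique by simp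
qed

text \<open>The relation is a linear condition on two values, hence closed under the pointwise
  limits that norm convergence provides.\<close>

lemma D_alg_covariant:
  assumes "\<Phi> \<in> D_alg c \<mu> \<nu>"
  shows "cnj (ee (of_int (c * k * p) * (y - of_int p * \<nu>))) * \<Phi> (x + of_int k, y) p = \<Phi> (x, y) p"
proof -
  obtain F where F: "\<And>n. F n \<in> D0 c \<nu>" "(\<lambda>n. cp_norm (lam \<mu> \<nu>) (\<Phi> - F n)) \<longlonglongrightarrow> 0"
    using assms by (auto simp: D_alg_def cp_closure_def)
  let ?e = "cnj (ee (of_int (c * k * p) * (y - of_int p * \<nu>)))"
  have "?e * F n (x + of_int k, y) p = F n (x, y) p" for n
    using F(1)[of n] by (auto simp: D0_def)
  moreover have "(\<lambda>n. ?e * F n (x + of_int k, y) p) \<longlonglongrightarrow> ?e * \<Phi> (x + of_int k, y) p"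
    by (intro tendsto_intros cp_closure_tendsto[OF zaction_inv_lam F(2)])
  ultimately show ?thesis
    using cp_closure_tendsto[OF zaction_inv_lam F(2), of "(x, y)" p] LIMSEQ_unique by simp
qed

section \<open>Elements of the completed bimodule as functions on the cylinder\<close>

lemma Xi_row:
  assumes "f \<in> Xi c \<mu> \<nu>"
  shows "ell2 (\<lambda>k. f (x + of_int k, y))"
  using assms by (simp add: Xi_def ell2_def)

lemma CcM_row:
  assumes "f \<in> CcM"
  shows "ell2 (\<lambda>k. f (x + of_int k, y))"
proof (rule ell2_finite)
  obtain B where B: "\<And>x y. B < \<bar>x\<bar> \<Longrightarrow> f (x, y) = 0"
    using assms by (auto simp: CcM_def)
  have "{k::int. f (x + of_int k, y) \<noteq> 0} \<subseteq> {\<lfloor>- \<bar>B\<bar> - x\<rfloor> .. \<lceil>\<bar>B\<bar> - x\<rceil>}"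
  proof
    fix k assume "k \<in> {k::int. f (x + of_int k, y) \<noteq> 0}"
    then have "\<bar>x + of_int k\<bar> \<le> \<bar>B\<bar>"
      using B[of "x + of_int k" y] by fastforce
    then show "k \<in> {\<lfloor>- \<bar>B\<bar> - x\<rfloor> .. \<lceil>\<bar>B\<bar> - x\<rceil>}"
      by (auto simp: floor_le_iff le_ceiling_iff)
  qed
  then show "finite {k::int. f (x + of_int k, y) \<noteq> 0}"
    by (rule finite_subset) simp
qed

text \<open>The zeroth coefficient of the right inner product of \<open>g\<close> with itself is the
  sum of its squared moduli along integer translates in \<open>x\<close>, which dominates the
  squared modulus at the point. Convergence in the module norm therefore implies pointwise
  convergence.\<close>

lemma Xi_approx:
  assumes "f \<in> Xi c \<mu> \<nu>"
  obtains F where "\<And>n. F n \<in> CcM" "\<And>m. (\<lambda>n. F n m) \<longlonglongrightarrow> f m"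
proof -
  obtain F where F: "\<And>n. F n \<in> CcM" "(\<lambda>n. Xi_normsq c \<mu> \<nu> (f - F n)) \<longlonglongrightarrow> 0"
    using assms by (auto simp: Xi_def)
  have "(\<lambda>n. F n m) \<longlonglongrightarrow> f m" for m
  proof -
    obtain x y where m: "m = (x, y)"
      by (cases m)
    define g where "g n = f - F n" for n
    have "(\<lambda>n. ipD c \<mu> \<nu> (g n) (g n) m 0) \<longlonglongrightarrow> 0"
      using F(2) unfolding g_def Xi_normsq_def by (rule cp_norm_tendsto_0_coeff_tendsto[OF zaction_inv_lam])
    then have lim: "(\<lambda>n. Re (ipD c \<mu> \<nu> (g n) (g n) m 0)) \<longlonglongrightarrow> 0"
      using tendsto_Re by fastforce
    have le: "(cmod (g n m))\<^sup>2 \<le> Re (ipD c \<mu> \<nu> (g n) (g n) m 0)" for n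
    proof -
      \<comment> \<open>Summability of this row keeps \<open>ipD\<close> from being the default
        value 0 of a divergent series.\<close>
      have row: "ell2 (\<lambda>k. g n (x + of_int k, y))"
        using ell2_add[OF Xi_row[OF assms] ell2_cmult[OF CcM_row[OF F(1)[of n]], of "-1"], of x y x y]
        by (simp add: g_def)
      then have s: "(\<lambda>k::int. (cmod (g n (x + of_int k, y)))\<^sup>2) summable_on UNIV"
        by (simp add: ell2_def)
      have "ipD c \<mu> \<nu> (g n) (g n) m 0 = (\<Sum>\<^sub>\<infinity>k::int. of_real ((cmod (g n (x + of_int k, y)))\<^sup>2))"
        by (simp add: ipD_def m complex_norm_square del: of_real_power)
      also have "\<dots> = of_real (\<Sum>\<^sub>\<infinity>k::int. (cmod (g n (x + of_int k, y)))\<^sup>2)"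
        using s by (intro infsumI has_sum_of_real) auto
      finally have "Re (ipD c \<mu> \<nu> (g n) (g n) m 0) = (\<Sum>\<^sub>\<infinity>k::int. (cmod (g n (x + of_int k, y)))\<^sup>2)"
        by simp
      then show ?thesis
        using finite_sum_le_infsum[OF s, of "{0}"] by (simp add: m)
    qed
    have "(\<lambda>n. (cmod (g n m))\<^sup>2) \<longlonglongrightarrow> 0"
      by (rule tendsto_sandwich[OF _ _ tendsto_const lim]) (auto simp: le)
    then have "(\<lambda>n. sqrt ((cmod (g n m))\<^sup>2)) \<longlonglongrightarrow> sqrt 0"
      by (rule tendsto_real_sqrt)
    then have "(\<lambda>n. g n m) \<longlonglongrightarrow> 0"
      by (simp add: tendsto_norm_zero_iff)
    then have "(\<lambda>n. f m - g n m) \<longlonglongrightarrow> f m - 0"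
      by (intro tendsto_intros)
    then show ?thesis
      by (simp add: g_def)
  qed
  then show thesis
    using that F(1) by blast
qed

lemma Xi_periodic:
  assumes "f \<in> Xi c \<mu> \<nu>"
  shows "f (x, y + 1) = f (x, y)"
proof -
  obtain F where F: "\<And>n. F n \<in> CcM" "\<And>m. (\<lambda>n. F n m) \<longlonglongrightarrow> f m"
    using Xi_approx[OF assms] by blast
  have "F n (x, y + 1) = F n (x, y)" for n
    using F(1)[of n] by (auto simp: CcM_def periodicM_def)
  then show ?thesis
    using F(2)[of "(x, y + 1)"] F(2)[of "(x, y)"] LIMSEQ_unique by simp
qed

text \<open>Pointwise limits of continuous functions are measurable, which the Tonelli arguments for
  the traces require.\<close>

lemma Xi_borel:
  assumes "f \<in> Xi c \<mu> \<nu>"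
  shows "f \<in> borel_measurable borel"
proof -
  obtain F where F: "\<And>n. F n \<in> CcM" "\<And>m. (\<lambda>n. F n m) \<longlonglongrightarrow> f m"
    using Xi_approx[OF assms] by blast
  have "F n \<in> borel_measurable borel" for n
    using F(1)[of n] by (intro borel_measurable_continuous_onI) (auto simp: CcM_def)
  then show ?thesis
    by (rule borel_measurable_LIMSEQ_metric) (rule F(2))
qed

section \<open>The bimodule in matrix form\<close>

text \<open>The matrix \<open>A(f)\<close> at the base point \<open>(x, y)\<close>.\<close>

definition mod_mat :: "int \<Rightarrow> real \<Rightarrow> real \<Rightarrow> mfun \<Rightarrow> real \<times> real \<Rightarrow> int \<Rightarrow> int \<Rightarrow> complex" where
  "mod_mat c \<mu> \<nu> f = (\<lambda>(x, y) p k. cnj (ee (of_int (c * k * p) * (y + of_int p * \<nu>)))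
     * f (x + 2 * of_int p * \<mu> + of_int k, y + 2 * of_int p * \<nu>))"

lemma mod_mat_0: "mod_mat c \<mu> \<nu> f (x, y) 0 k = f (x + of_int k, y)"
  by (simp add: mod_mat_def)

text \<open>The phase in \<open>mod_mat\<close> is quadratic in \<open>p\<close>, so that the phases
  of rows \<open>p\<close> and \<open>q\<close> combine to the phase of \<open>ipD\<close> at the
  point \<open>lam \<mu> \<nu> p m\<close> in degree \<open>p - q\<close>.\<close>

lemma mod_mat_gram:
  "(\<Sum>\<^sub>\<infinity>k. mod_mat c \<mu> \<nu> f m p k * cnj (mod_mat c \<mu> \<nu> g m q k)) = reg_mat (lam \<mu> \<nu>) (ipD c \<mu> \<nu> f g) m p q"
proof -
  obtain x y where m: "m = (x, y)"
    by (cases m)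
  have "mod_mat c \<mu> \<nu> f m p k * cnj (mod_mat c \<mu> \<nu> g m q k)
     = cnj (ee (of_int (c * k * (p - q)) * (y + 2 * of_int p * \<nu> - of_int (p - q) * \<nu>)))
       * f (x + 2 * of_int p * \<mu> + of_int k, y + 2 * of_int p * \<nu>)
       * cnj (g (x + 2 * of_int p * \<mu> - 2 * of_int (p - q) * \<mu> + of_int k, y + 2 * of_int p * \<nu> - 2 * of_int (p - q) * \<nu>))" for k
  proof -
    have e: "cnj (ee (of_int (c * k * (p - q)) * (y + 2 * of_int p * \<nu> - of_int (p - q) * \<nu>)))
        = cnj (ee (of_int (c * k * p) * (y + of_int p * \<nu>))) * ee (of_int (c * k * q) * (y + of_int q * \<nu>))"
      unfolding cnj_ee ee_add[symmetric] by (rule arg_cong[of _ _ ee]) (simp add: algebra_simps)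
    have xy: "x + 2 * of_int p * \<mu> - 2 * of_int (p - q) * \<mu> + of_int k = x + 2 * of_int q * \<mu> + of_int k"
      "y + 2 * of_int p * \<nu> - 2 * of_int (p - q) * \<nu> = y + 2 * of_int q * \<nu>"
      by (simp_all add: algebra_simps)
    show ?thesis
      unfolding e xy m mod_mat_def prod.case by (simp only: complex_cnj_mult complex_cnj_cnj mult_ac)
  qed
  then show ?thesis
    by (simp add: reg_mat_def lam_def ipD_def m)
qed

text \<open>Column \<open>k\<close> at a point is, up to phases, column 0 at its translate by
  \<open>k\<close> in \<open>x\<close>, and the phases of columns \<open>k\<close> and
  \<open>l\<close> combine to that of \<open>ipE\<close> in degree \<open>l - k\<close>. The series
  of \<open>ipE\<close> runs opposite to the row index.\<close>

lemma mod_mat_cogram: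
  "(\<Sum>\<^sub>\<infinity>p. cnj (mod_mat c \<mu> \<nu> f (x, y) p k) * mod_mat c \<mu> \<nu> g (x, y) p l) = ipE c \<mu> \<nu> f g (x + of_int k, y) (l - k)"
proof -
  have "cnj (mod_mat c \<mu> \<nu> f (x, y) (- j) k) * mod_mat c \<mu> \<nu> g (x, y) (- j) l
     = ee (of_int (c * (l - k) * j) * (y - of_int j * \<nu>))
        * cnj (f (x + of_int k - 2 * of_int j * \<mu>, y - 2 * of_int j * \<nu>))
        * g (x + of_int k - 2 * of_int j * \<mu> + of_int (l - k), y - 2 * of_int j * \<nu>)" for j
  proof -
    have e: "ee (of_int (c * (l - k) * j) * (y - of_int j * \<nu>))
        = ee (of_int (c * k * (- j)) * (y + of_int (- j) * \<nu>)) * cnj (ee (of_int (c * l * (- j)) * (y + of_int (- j) * \<nu>)))"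
      unfolding cnj_ee ee_add[symmetric] by (rule arg_cong[of _ _ ee]) (simp add: algebra_simps)
    have xy: "x + of_int k - 2 * of_int j * \<mu> = x + 2 * of_int (- j) * \<mu> + of_int k"
      "x + 2 * of_int (- j) * \<mu> + of_int k + of_int (l - k) = x + 2 * of_int (- j) * \<mu> + of_int l"
      "y - 2 * of_int j * \<nu> = y + 2 * of_int (- j) * \<nu>"
      by (simp_all add: algebra_simps)
    show ?thesis
      unfolding e xy mod_mat_def prod.case by (simp only: complex_cnj_mult complex_cnj_cnj mult_ac)
  qed
  then have "ipE c \<mu> \<nu> f g (x + of_int k, y) (l - k)
     = (\<Sum>\<^sub>\<infinity>j. cnj (mod_mat c \<mu> \<nu> f (x, y) (- j) k) * mod_mat c \<mu> \<nu> g (x, y) (- j) l)"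
    by (simp add: ipE_def)
  also have "\<dots> = (\<Sum>\<^sub>\<infinity>p. cnj (mod_mat c \<mu> \<nu> f (x, y) p k) * mod_mat c \<mu> \<nu> g (x, y) p l)"
    by (rule infsum_reindex_bij_witness[of _ uminus uminus]) auto
  finally show ?thesis ..
qed

text \<open>The conjugate in \<open>actD\<close> makes \<Phi> act as left multiplication by the
  adjoint of its regular matrix. Covariance of \<Phi> under integer translations in \<open>x\<close>
  lets the same matrix serve every column \<open>k\<close>.\<close>

lemma mod_mat_actD:
  assumes "\<Phi> \<in> D_alg c \<mu> \<nu>"
  shows "mod_mat c \<mu> \<nu> (actD \<mu> \<nu> f \<Phi>) m p k
    = (\<Sum>\<^sub>\<infinity>j. cnj (reg_mat (lam \<mu> \<nu>) \<Phi> m j p) * mod_mat c \<mu> \<nu> f m j k)"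
proof -
  obtain x y where m: "m = (x, y)"
    by (cases m)
  let ?e = "cnj (ee (of_int (c * k * p) * (y + of_int p * \<nu>)))"
  have summand: "?e * (f (x + 2 * of_int p * \<mu> + of_int k + 2 * of_int q * \<mu>, y + 2 * of_int p * \<nu> + 2 * of_int q * \<nu>)
        * cnj (\<Phi> (x + 2 * of_int p * \<mu> + of_int k + 2 * of_int q * \<mu>, y + 2 * of_int p * \<nu> + 2 * of_int q * \<nu>) q))
      = cnj (reg_mat (lam \<mu> \<nu>) \<Phi> m (p + q) p) * mod_mat c \<mu> \<nu> f m (p + q) k" for q
  proof -
    let ?x = "x + 2 * of_int (p + q) * \<mu>" and ?y = "y + 2 * of_int (p + q) * \<nu>"
    have xy: "x + 2 * of_int p * \<mu> + of_int k + 2 * of_int q * \<mu> = ?x + of_int k"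
      "y + 2 * of_int p * \<nu> + 2 * of_int q * \<nu> = ?y"
      by (simp_all add: algebra_simps)
    have "ee (of_int (c * k * q) * (?y - of_int q * \<nu>)) * \<Phi> (?x, ?y) q
        = ee (of_int (c * k * q) * (?y - of_int q * \<nu>)) * cnj (ee (of_int (c * k * q) * (?y - of_int q * \<nu>))) * \<Phi> (?x + of_int k, ?y) q"
      using D_alg_covariant[OF assms, of k q ?y ?x] by (simp add: mult.assoc)
    then have \<Phi>: "\<Phi> (?x + of_int k, ?y) q = ee (of_int (c * k * q) * (?y - of_int q * \<nu>)) * \<Phi> (?x, ?y) q"
      by (simp add: cnj_ee ee_add[symmetric])
    have e: "cnj (ee (of_int (c * k * (p + q)) * (y + of_int (p + q) * \<nu>)))
        = ?e * cnj (ee (of_int (c * k * q) * (?y - of_int q * \<nu>)))"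
      unfolding cnj_ee ee_add[symmetric] by (rule arg_cong[of _ _ ee]) (simp add: algebra_simps)
    have mm: "mod_mat c \<mu> \<nu> f m (p + q) k
        = cnj (ee (of_int (c * k * (p + q)) * (y + of_int (p + q) * \<nu>))) * f (?x + of_int k, ?y)"
      by (simp only: m mod_mat_def prod.case)
    have rr: "reg_mat (lam \<mu> \<nu>) \<Phi> m (p + q) p = \<Phi> (?x, ?y) q"
      by (simp add: m reg_mat_def lam_def)
    show ?thesis
      unfolding xy \<Phi> mm rr e by (simp only: complex_cnj_mult mult_ac)
  qed
  have "mod_mat c \<mu> \<nu> (actD \<mu> \<nu> f \<Phi>) m p k
      = (\<Sum>\<^sub>\<infinity>q. ?e * (f (x + 2 * of_int p * \<mu> + of_int k + 2 * of_int q * \<mu>, y + 2 * of_int p * \<nu> + 2 * of_int q * \<nu>)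
        * cnj (\<Phi> (x + 2 * of_int p * \<mu> + of_int k + 2 * of_int q * \<mu>, y + 2 * of_int p * \<nu> + 2 * of_int q * \<nu>) q)))"
    by (simp only: m mod_mat_def actD_def prod.case infsum_cmult_right')
  also have "\<dots> = (\<Sum>\<^sub>\<infinity>q. cnj (reg_mat (lam \<mu> \<nu>) \<Phi> m (p + q) p) * mod_mat c \<mu> \<nu> f m (p + q) k)"
    by (simp only: summand)
  also have "\<dots> = (\<Sum>\<^sub>\<infinity>j. cnj (reg_mat (lam \<mu> \<nu>) \<Phi> m j p) * mod_mat c \<mu> \<nu> f m j k)"
    by (rule infsum_reindex_bij_witness[of _ "\<lambda>j. j - p" "\<lambda>q. p + q"]) auto
  finally show ?thesis .
qed

text \<open>Taking the middle matrix index to be \<open>p - s\<close>, with \<open>s\<close> the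
  convolution index, turns convolution into matrix multiplication.\<close>

lemma reg_mat_cp_mult:
  "reg_mat (lam \<mu> \<nu>) (cp_mult (lam \<mu> \<nu>) \<Phi> \<Psi>) m p q
    = (\<Sum>\<^sub>\<infinity>k. reg_mat (lam \<mu> \<nu>) \<Phi> m p k * reg_mat (lam \<mu> \<nu>) \<Psi> m k q)"
proof -
  have "lam \<mu> \<nu> (- s) (lam \<mu> \<nu> p m) = lam \<mu> \<nu> (p - s) m" for s
    by (auto simp: lam_def algebra_simps split: prod.split)
  then have "reg_mat (lam \<mu> \<nu>) (cp_mult (lam \<mu> \<nu>) \<Phi> \<Psi>) m p q
      = (\<Sum>\<^sub>\<infinity>s. \<Phi> (lam \<mu> \<nu> p m) s * \<Psi> (lam \<mu> \<nu> (p - s) m) (p - q - s))"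
    by (simp add: reg_mat_def cp_mult_def)
  also have "\<dots> = (\<Sum>\<^sub>\<infinity>k. reg_mat (lam \<mu> \<nu>) \<Phi> m p k * reg_mat (lam \<mu> \<nu>) \<Psi> m k q)"
    by (rule infsum_reindex_bij_witness[of _ "\<lambda>k. p - k" "\<lambda>s. p - s"]) (auto simp: reg_mat_def algebra_simps)
  finally show ?thesis .
qed

definition opX :: "int \<Rightarrow> real \<Rightarrow> real \<Rightarrow> mfun \<Rightarrow> real \<times> real \<Rightarrow> bmat" where
  "opX c \<mu> \<nu> f m = Bmat (mod_mat c \<mu> \<nu> f m)"

text \<open>The rows are square-summable by the definition of \<open>Xi\<close>, and the Gram matrix
  is the regular matrix of an element of \<open>D_alg\<close>.\<close>

lemma mod_mat_bdd_mat:
  assumes "f \<in> Xi c \<mu> \<nu>" and "ipD c \<mu> \<nu> f f \<in> D_alg c \<mu> \<nu>"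
  shows "bdd_mat (mod_mat c \<mu> \<nu> f m)"
proof (rule bdd_mat_if_gram)
  show "ell2 (mod_mat c \<mu> \<nu> f m p)" for p
    using Xi_row[OF assms(1), of "fst m + 2 * of_int p * \<mu>" "snd m + 2 * of_int p * \<nu>"]
    by (simp add: ell2_def mod_mat_def norm_mult case_prod_beta)
  show "bdd_mat (\<lambda>p q. \<Sum>\<^sub>\<infinity>k. mod_mat c \<mu> \<nu> f m p k * cnj (mod_mat c \<mu> \<nu> f m q k))"
    using D_alg_bdd_mat[OF assms(2)] by (simp add: mod_mat_gram)
qed

section \<open>Smooth bimodule elements as operators\<close>

locale smooth_bimod =
  fixes c :: int and \<mu> \<nu> :: real and Einf :: "cpfun set" and Xinf :: "mfun set"
  assumes smooth: "smooth_bimodule c \<mu> \<nu> Einf Xinf"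
begin

abbreviation "X \<equiv> opX c \<mu> \<nu>"

lemma Xinf_Xi: "f \<in> Xinf \<Longrightarrow> f \<in> Xi c \<mu> \<nu>"
  and Xinf_add: "f \<in> Xinf \<Longrightarrow> g \<in> Xinf \<Longrightarrow> f + g \<in> Xinf"
  and Xinf_cmult: "f \<in> Xinf \<Longrightarrow> (\<lambda>m. a * f m) \<in> Xinf"
  and Xinf_actD: "f \<in> Xinf \<Longrightarrow> \<Phi> \<in> D_smooth c \<mu> \<nu> \<Longrightarrow> actD \<mu> \<nu> f \<Phi> \<in> Xinf"
  and ipD_smooth: "f \<in> Xinf \<Longrightarrow> g \<in> Xinf \<Longrightarrow> ipD c \<mu> \<nu> f g \<in> D_smooth c \<mu> \<nu>"
  and ipE_E_alg: "f \<in> Xinf \<Longrightarrow> g \<in> Xinf \<Longrightarrow> ipE c \<mu> \<nu> f g \<in> E_alg c \<mu> \<nu>"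
  using smooth by (auto simp: smooth_bimodule_def)

lemma ipD_D_alg: "f \<in> Xinf \<Longrightarrow> g \<in> Xinf \<Longrightarrow> ipD c \<mu> \<nu> f g \<in> D_alg c \<mu> \<nu>"
  using ipD_smooth by (auto simp: D_smooth_def)

lemma Xinf_diff: "f \<in> Xinf \<Longrightarrow> g \<in> Xinf \<Longrightarrow> f - g \<in> Xinf"
  using Xinf_add[OF _ Xinf_cmult[of g "-1"], of f] by (simp add: fun_diff_def plus_fun_def)

lemma entry_X: "f \<in> Xinf \<Longrightarrow> entry (X f m) = mod_mat c \<mu> \<nu> f m"
  by (simp add: opX_def entry_Bmat mod_mat_bdd_mat Xinf_Xi ipD_D_alg)

lemma X_add: "f \<in> Xinf \<Longrightarrow> g \<in> Xinf \<Longrightarrow> X (f + g) m = X f m + X g m"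
  by (rule bmat_eqI) (simp add: entry_simps entry_X Xinf_add mod_mat_def distrib_left case_prod_beta)

lemma X_diff: "f \<in> Xinf \<Longrightarrow> g \<in> Xinf \<Longrightarrow> X (f - g) m = X f m - X g m"
  by (rule bmat_eqI) (simp add: entry_simps entry_X Xinf_diff mod_mat_def right_diff_distrib case_prod_beta)

lemma X_zero_iff:
  assumes "f \<in> Xinf" and "\<And>m. f m = 0"
  shows "X f m = 0"
  by (rule bmat_eqI) (simp add: entry_simps entry_X assms mod_mat_def case_prod_beta)

lemma reg_mat_ipD:
  "f \<in> Xinf \<Longrightarrow> g \<in> Xinf \<Longrightarrow> reg_mat (lam \<mu> \<nu>) (ipD c \<mu> \<nu> f g) m = entry (X f m * adj (X g m))"
  by (intro ext) (simp add: entry_simps entry_X mod_mat_gram)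

lemma ipD_entry: "f \<in> Xinf \<Longrightarrow> g \<in> Xinf \<Longrightarrow> ipD c \<mu> \<nu> f g m 0 = entry (X f m * adj (X g m)) 0 0"
  by (cases m) (simp add: reg_mat_ipD[symmetric] reg_mat_def lam_def)

lemma ipE_entry:
  "f \<in> Xinf \<Longrightarrow> g \<in> Xinf \<Longrightarrow> ipE c \<mu> \<nu> f g (x + of_int k, y) (l - k) = entry (adj (X f (x, y)) * X g (x, y)) k l"
  by (simp add: entry_simps entry_X mod_mat_cogram)

lemma ipE_entry_0: "f \<in> Xinf \<Longrightarrow> g \<in> Xinf \<Longrightarrow> ipE c \<mu> \<nu> f g m q = entry (adj (X f m) * X g m) 0 q"
  using ipE_entry[of f g "fst m" 0 "snd m" q] by simp

text \<open>The action by \<open>ipD c \<mu> \<nu> g h\<close> is left multiplication by the adjoint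
  of \<open>X g m * adj (X h m)\<close>, which reverses the order of \<open>g\<close> and
  \<open>h\<close>. Products of this shape therefore come from elements of \<open>Xinf\<close>,
  where traces of inner products are available.\<close>

lemma X_triple:
  assumes "f \<in> Xinf" "g \<in> Xinf" "h \<in> Xinf"
  shows "X (actD \<mu> \<nu> f (ipD c \<mu> \<nu> g h)) m = X h m * adj (X g m) * X f m"
proof (rule bmat_eqI)
  fix p k
  have "entry (X h m * adj (X g m) * X f m) p k
     = (\<Sum>\<^sub>\<infinity>j. cnj (entry (adj (X h m * adj (X g m))) j p) * entry (X f m) j k)"
    by (simp add: entry_simps(6)[of "X h m * adj (X g m)"])
  also have "adj (X h m * adj (X g m)) = X g m * adj (X h m)"
    by (simp add: adj_simps)
  finally show "entry (X (actD \<mu> \<nu> f (ipD c \<mu> \<nu> g h)) m) p k = entry (X h m * adj (X g m) * X f m) p k"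
    using assms by (simp add: entry_X Xinf_actD ipD_smooth mod_mat_actD ipD_D_alg reg_mat_ipD)
qed

lemma Xinf_triple: "f \<in> Xinf \<Longrightarrow> g \<in> Xinf \<Longrightarrow> h \<in> Xinf \<Longrightarrow> actD \<mu> \<nu> f (ipD c \<mu> \<nu> g h) \<in> Xinf"
  by (intro Xinf_actD ipD_smooth)

text \<open>Row 0 of \<open>X f m\<close> lists the values of \<open>f\<close> at the integer
  translates of \<open>m\<close> in \<open>x\<close>, so pairing it with row 0 of \<open>S\<close>
  reproduces the series of \<open>actE\<close>.\<close>

lemma actE_entry:
  assumes "f \<in> Xinf" and "\<And>q. T m q = entry S 0 q"
  shows "actE T f m = entry (X f m * adj S) 0 0"
proof -
  obtain x y where "m = (x, y)"
    by (cases m)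
  then show ?thesis
    using assms by (simp add: actE_def entry_simps entry_X mod_mat_0 mult.commute)
qed

end

section \<open>The traces\<close>

lemma nn_integral_indicator_translates:
  fixes L t :: real
  assumes "0 < L"
  shows "(\<integral>\<^sup>+k. indicator {t..<t + L} (x + of_int k * L) \<partial>count_space (UNIV :: int set)) = (1 :: ennreal)"
proof -
  \<comment> \<open>The half-open interval makes the translate unique: \<open>k\<close> must be the
    ceiling of \<open>(t - x) / L\<close>.\<close>
  have iff: "x + of_int k * L \<in> {t..<t + L} \<longleftrightarrow> k = \<lceil>(t - x) / L\<rceil>" for k :: int
  proof -
    have "x + of_int k * L \<in> {t..<t + L} \<longleftrightarrow> (t - x) / L \<le> of_int k \<and> of_int k - 1 < (t - x) / L"
      using assms by (auto simp: field_simps)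
    also have "\<dots> \<longleftrightarrow> k = \<lceil>(t - x) / L\<rceil>"
      by linarith
    finally show ?thesis .
  qed
  then have "(\<integral>\<^sup>+k. indicator {t..<t + L} (x + of_int k * L) \<partial>count_space UNIV)
      = (\<integral>\<^sup>+k. indicator {\<lceil>(t - x) / L\<rceil>} k \<partial>count_space (UNIV :: int set))"
    by (intro nn_integral_cong) (simp add: indicator_def)
  also have "\<dots> = 1"
    by simp
  finally show ?thesis .
qed

text \<open>The translates of \<open>{0..<L}\<close> tile the line: after a change of variable in
  each term, Tonelli leaves the number of translates that contain \<open>x\<close>, which is
  1.\<close>

lemma nn_integral_periodization:
  fixes g :: "real \<Rightarrow> ennreal"
  assumes [measurable]: "g \<in> borel_measurable borel" and L: "0 < L"
  shows "(\<integral>\<^sup>+k. \<integral>\<^sup>+x. g (x + of_int k * L) * indicator {0..<L} x \<partial>lborel \<partial>count_space (UNIV :: int set))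
    = (\<integral>\<^sup>+x. g x \<partial>lborel)"
proof -
  have "(\<integral>\<^sup>+x. g (x + of_int k * L) * indicator {0..<L} x \<partial>lborel)
      = (\<integral>\<^sup>+x. g x * indicator {0..<L} (x + of_int (- k) * L) \<partial>lborel)" for k :: int
    using nn_integral_real_affine[of "\<lambda>x. g x * indicator {0..<L} (x + of_int (- k) * L)" 1 "of_int k * L"]
    by (simp add: add.commute)
  then have "(\<integral>\<^sup>+k. \<integral>\<^sup>+x. g (x + of_int k * L) * indicator {0..<L} x \<partial>lborel \<partial>count_space (UNIV :: int set))
      = (\<integral>\<^sup>+k. \<integral>\<^sup>+x. g x * indicator {0..<L} (x + of_int (- k) * L) \<partial>lborel \<partial>count_space UNIV)"
    by simp
  also have "\<dots> = (\<integral>\<^sup>+x. \<integral>\<^sup>+k. g x * indicator {0..<L} (x + of_int (- k) * L) \<partial>count_space (UNIV :: int set) \<partial>lborel)"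
    by (intro nn_integral_count_space_nn_integral[symmetric]) auto
  also have "\<dots> = (\<integral>\<^sup>+x. g x * (\<integral>\<^sup>+k. indicator {0..<L} (x + of_int (- k) * L) \<partial>count_space (UNIV :: int set)) \<partial>lborel)"
    by (simp add: nn_integral_cmult)
  also have "\<dots> = (\<integral>\<^sup>+x. g x \<partial>lborel)"
  proof (intro nn_integral_cong)
    fix x
    have "(\<integral>\<^sup>+k. indicator {0..<L} (x + of_int (- k) * L) \<partial>count_space (UNIV :: int set))
        = (\<integral>\<^sup>+k. indicator {0..<0 + L} (x + of_int k * L) \<partial>count_space (UNIV :: int set))"
      by (subst nn_integral_bij_count_space[of uminus UNIV UNIV, symmetric])
        (auto simp: bij_betw_def inj_on_def surj_def intro: exI[of _ "- y" for y])
    then show "g x * (\<integral>\<^sup>+k. indicator {0..<L} (x + of_int (- k) * L) \<partial>count_space (UNIV :: int set)) = g x"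
      by (simp only: nn_integral_indicator_translates[OF L] mult_1_right)
  qed
  finally show ?thesis .
qed

lemma periodic_add_int:
  fixes g :: "real \<Rightarrow> 'a"
  assumes "\<And>y. g (y + 1) = g y"
  shows "g (y + of_int k) = g y"
proof (induction k rule: int_induct[of _ 0])
  case (step1 i)
  then show ?case
    using assms[of "y + of_int i"] by (simp add: add.assoc)
next
  case (step2 i)
  then show ?case
    using assms[of "y + of_int i - 1"] by (simp add: algebra_simps)
qed simp

text \<open>Periodization with period 1 cuts \<open>{t..<t + 1}\<close> at the integers; since
  \<open>g\<close> is periodic, the pieces reassemble on \<open>{0..<1}\<close>.\<close>

lemma nn_integral_periodic_shift:
  fixes g :: "real \<Rightarrow> ennreal"
  assumes [measurable]: "g \<in> borel_measurable borel" and per: "\<And>y. g (y + 1) = g y"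
  shows "(\<integral>\<^sup>+y. g (y + t) * indicator {0..<1} y \<partial>lborel) = (\<integral>\<^sup>+y. g y * indicator {0..<1} y \<partial>lborel)"
proof -
  have "(\<integral>\<^sup>+y. g (y + t) * indicator {0..<1} y \<partial>lborel) = (\<integral>\<^sup>+y. g y * indicator {t..<t + 1} y \<partial>lborel)"
    using nn_integral_real_affine[of "\<lambda>y. g y * indicator {t..<t + 1} y" 1 t]
    by (simp add: add.commute indicator_def algebra_simps)
  also have "\<dots> = (\<integral>\<^sup>+k. \<integral>\<^sup>+y. g (y + of_int k * 1) * indicator {t..<t + 1} (y + of_int k * 1) * indicator {0..<1} y \<partial>lborel \<partial>count_space (UNIV :: int set))"
    by (rule nn_integral_periodization[symmetric]) auto
  also have "\<dots> = (\<integral>\<^sup>+y. \<integral>\<^sup>+k. g y * indicator {0..<1} y * indicator {t..<t + 1} (y + of_int k * 1) \<partial>count_space (UNIV :: int set) \<partial>lborel)"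
    by (subst nn_integral_count_space_nn_integral) (simp_all add: periodic_add_int[of g, OF per] mult_ac)
  also have "\<dots> = (\<integral>\<^sup>+y. g y * indicator {0..<1} y * (\<integral>\<^sup>+k. indicator {t..<t + 1} (y + of_int k * 1) \<partial>count_space (UNIV :: int set)) \<partial>lborel)"
    by (simp add: nn_integral_cmult)
  also have "\<dots> = (\<integral>\<^sup>+y. g y * indicator {0..<1} y \<partial>lborel)"
    using nn_integral_indicator_translates[OF zero_less_one, of t] by simp
  finally show ?thesis .
qed

text \<open>The lattice generated by \<open>(L, s)\<close> acts on the cylinder with fundamental
  domain \<open>{0..<L}\<close> times the circle. The shift by \<open>s\<close> disappears in the
  integral over the circle, and the tiling in \<open>x\<close> remains. It is applied to
  \<open>(1, 0)\<close> and \<open>(2 * \<mu>, 2 * \<nu>)\<close>.\<close>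

lemma nn_integral_strip_periodization:
  fixes h :: "real \<times> real \<Rightarrow> ennreal"
  assumes h[measurable]: "h \<in> borel_measurable borel" and per: "\<And>x y. h (x, y + 1) = h (x, y)" and L: "0 < L"
  shows "(\<integral>\<^sup>+y. (\<integral>\<^sup>+x. (\<integral>\<^sup>+k. h (x + of_int k * L, y + of_int k * s) \<partial>count_space (UNIV :: int set))
      * indicator {0..<L} x \<partial>lborel) * indicator {0..<1} y \<partial>lborel)
    = (\<integral>\<^sup>+y. (\<integral>\<^sup>+x. h (x, y) \<partial>lborel) * indicator {0..<1} y \<partial>lborel)"
proof -
  have [measurable]: "(\<lambda>(x, y). h (x + a, y + b)) \<in> borel_measurable (borel \<Otimes>\<^sub>M borel)" for a b
    unfolding borel_prod split_beta'
    by (rule measurable_compose[OF _ h]) (intro borel_measurable_continuous_onI continuous_intros)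
  define G where "G k y = (\<integral>\<^sup>+x. h (x + of_int k * L, y) * indicator {0..<L} x \<partial>lborel)" for k :: int and y
  have G[measurable]: "G k \<in> borel_measurable borel" for k
    unfolding G_def by measurable
  have "(\<integral>\<^sup>+x. (\<integral>\<^sup>+k. h (x + of_int k * L, y + of_int k * s) \<partial>count_space (UNIV :: int set)) * indicator {0..<L} x \<partial>lborel)
      = (\<integral>\<^sup>+k. G k (y + of_int k * s) \<partial>count_space UNIV)" for y
    unfolding G_def by (subst nn_integral_count_space_nn_integral[symmetric]) (simp_all add: nn_integral_multc)
  then have "(\<integral>\<^sup>+y. (\<integral>\<^sup>+x. (\<integral>\<^sup>+k. h (x + of_int k * L, y + of_int k * s) \<partial>count_space (UNIV :: int set))
      * indicator {0..<L} x \<partial>lborel) * indicator {0..<1} y \<partial>lborel)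
    = (\<integral>\<^sup>+y. \<integral>\<^sup>+k. G k (y + of_int k * s) * indicator {0..<1} y \<partial>count_space UNIV \<partial>lborel)"
    by (simp add: nn_integral_multc)
  also have "\<dots> = (\<integral>\<^sup>+k. \<integral>\<^sup>+y. G k (y + of_int k * s) * indicator {0..<1} y \<partial>lborel \<partial>count_space UNIV)"
    by (intro nn_integral_count_space_nn_integral) auto
  also have "\<dots> = (\<integral>\<^sup>+k. \<integral>\<^sup>+y. G k y * indicator {0..<1} y \<partial>lborel \<partial>count_space UNIV)"
    by (subst nn_integral_periodic_shift[OF G]) (simp_all add: G_def per)
  also have "\<dots> = (\<integral>\<^sup>+y. \<integral>\<^sup>+k. G k y * indicator {0..<1} y \<partial>count_space UNIV \<partial>lborel)"
    by (intro nn_integral_count_space_nn_integral[symmetric]) auto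
  also have "\<dots> = (\<integral>\<^sup>+y. (\<integral>\<^sup>+k. G k y \<partial>count_space UNIV) * indicator {0..<1} y \<partial>lborel)"
    by (simp add: nn_integral_multc)
  also have "\<dots> = (\<integral>\<^sup>+y. (\<integral>\<^sup>+x. h (x, y) \<partial>lborel) * indicator {0..<1} y \<partial>lborel)"
    unfolding G_def by (subst nn_integral_periodization[OF _ L]) measurable
  finally show ?thesis .
qed

text \<open>The traces integrate over closed boxes while the foldings use half-open intervals; the
  edges are null sets.\<close>

lemma nn_integral_box_eq_integral:
  fixes \<phi> :: "real \<times> real \<Rightarrow> real"
  assumes cont: "continuous_on UNIV \<phi>" and nonneg: "\<And>m. 0 \<le> \<phi> m"
  shows "(\<integral>\<^sup>+y. (\<integral>\<^sup>+x. ennreal (\<phi> (x, y)) * indicator {0..<L} x \<partial>lborel) * indicator {0..<1} y \<partial>lborel)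
    = ennreal (integral (cbox (0, 0) (L, 1)) \<phi>)"
proof -
  have [measurable]: "\<phi> \<in> borel_measurable borel"
    by (rule borel_measurable_continuous_onI[OF cont])
  have [measurable]: "\<phi> \<in> borel_measurable (borel \<Otimes>\<^sub>M borel)"
    by (simp add: borel_prod)
  have "\<phi> integrable_on cbox (0, 0) (L, 1)"
    by (intro integrable_continuous continuous_on_subset[OF cont]) auto
  then have "ennreal (integral (cbox (0, 0) (L, 1)) \<phi>)
      = (\<integral>\<^sup>+m. ennreal (\<phi> m) * indicator (cbox (0, 0) (L, 1)) m \<partial>lborel)"
    using nonneg by (intro nn_integral_has_integral_lebesgue'[symmetric]) auto
  also have "\<dots> = (\<integral>\<^sup>+m. ennreal (\<phi> m) * indicator (cbox (0, 0) (L, 1)) m \<partial>(lborel \<Otimes>\<^sub>M lborel))"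
    by (simp add: lborel_prod)
  also have "\<dots> = (\<integral>\<^sup>+y. \<integral>\<^sup>+x. ennreal (\<phi> (x, y)) * indicator (cbox (0, 0) (L, 1)) (x, y) \<partial>lborel \<partial>lborel)"
    by (rule lborel_pair.nn_integral_snd[symmetric]) (unfold lborel_prod, measurable)
  also have "\<dots> = (\<integral>\<^sup>+y. \<integral>\<^sup>+x. ennreal (\<phi> (x, y)) * indicator {0..L} x * indicator {0..1} y \<partial>lborel \<partial>lborel)"
    by (intro nn_integral_cong) (auto simp: indicator_def cbox_Pair_eq)
  also have "\<dots> = (\<integral>\<^sup>+y. (\<integral>\<^sup>+x. ennreal (\<phi> (x, y)) * indicator {0..L} x \<partial>lborel) * indicator {0..1} y \<partial>lborel)"
    by (intro nn_integral_cong nn_integral_multc) auto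
  also have "\<dots> = (\<integral>\<^sup>+y. (\<integral>\<^sup>+x. ennreal (\<phi> (x, y)) * indicator {0..<L} x \<partial>lborel) * indicator {0..1} y \<partial>lborel)"
    by (intro nn_integral_cong arg_cong2[of _ _ _ _ "(*)"] refl nn_integral_cong_AE
        eventually_mono[OF AE_lborel_singleton[of L]]) (auto simp: indicator_def)
  also have "\<dots> = (\<integral>\<^sup>+y. (\<integral>\<^sup>+x. ennreal (\<phi> (x, y)) * indicator {0..<L} x \<partial>lborel) * indicator {0..<1} y \<partial>lborel)"
    by (intro nn_integral_cong_AE eventually_mono[OF AE_lborel_singleton[of 1]]) (auto simp: indicator_def)
  finally show ?thesis ..
qed

lemma nn_integral_count_space_infsum:
  fixes f :: "'a \<Rightarrow> real"
  assumes "f summable_on A" and "\<And>x. 0 \<le> f x"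
  shows "(\<integral>\<^sup>+x. ennreal (f x) \<partial>count_space A) = ennreal (infsum f A)"
proof -
  have "Infinite_Set_Sum.abs_summable_on f A"
    using assms by (subst abs_summable_equivalent[symmetric]) simp
  then show ?thesis
    using assms(2) by (simp add: nn_integral_conv_infsetsum infsetsum_infsum)
qed

lemma integral_box_iterated:
  fixes \<phi> :: "real \<times> real \<Rightarrow> 'a::banach"
  assumes "continuous_on UNIV \<phi>"
  shows "integral {0..1} (\<lambda>y. integral {0..L} (\<lambda>x. \<phi> (x, y))) = integral (cbox (0, 0) (L, 1::real)) \<phi>"
proof -
  have c: "continuous_on (cbox (0, 0) (L, 1)) \<phi>"
    using assms continuous_on_subset by blast
  then show ?thesis
    using integral_swap_continuous[of 0 0 L 1 "\<lambda>x y. \<phi> (x, y)"] integral_prod_continuous[OF c] by simp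
qed

lemma box_integrable:
  fixes \<phi> :: "real \<times> real \<Rightarrow> complex"
  shows "continuous_on UNIV \<phi> \<Longrightarrow> \<phi> integrable_on cbox a b"
  by (rule integrable_continuous, rule continuous_on_subset) auto

lemma integral_complex_of_real:
  "\<phi> integrable_on S \<Longrightarrow> integral S (\<lambda>x. complex_of_real (\<phi> x)) = of_real (integral S \<phi>)"
  by (intro integral_unique has_integral_of_real integrable_integral)

lemma tauE_box:
  assumes "continuous_on UNIV (\<lambda>m. \<Psi> m 0)"
  shows "tauE \<mu> \<Psi> = integral (cbox (0, 0) (2 * \<mu>, 1)) (\<lambda>m. \<Psi> m 0)"
  unfolding tauE_def by (rule integral_box_iterated[OF assms])

text \<open>Polarization weighted by the fourth roots of unity reduces a sesquilinear integrand to
  four diagonal ones, for which nonnegativity is available.\<close>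

lemma integral_polarization:
  fixes q :: "complex \<Rightarrow> real \<times> real \<Rightarrow> complex"
  assumes "\<And>a. continuous_on UNIV (q a)"
    and "\<And>m. q 1 m - q (-1) m + \<i> * q \<i> m - \<i> * q (- \<i>) m = 4 * r m"
  shows "integral (cbox a b) r = (integral (cbox a b) (q 1) - integral (cbox a b) (q (-1))
    + \<i> * integral (cbox a b) (q \<i>) - \<i> * integral (cbox a b) (q (- \<i>))) / 4"
proof -
  have i: "q s integrable_on cbox a b" for s
    by (rule box_integrable[OF assms(1)])
  have "r = (\<lambda>m. (q 1 m - q (-1) m + \<i> * q \<i> m - \<i> * q (- \<i>) m) / 4)"
    using assms(2) by auto
  then have "integral (cbox a b) r = integral (cbox a b) (\<lambda>m. (q 1 m - q (-1) m + \<i> * q \<i> m - \<i> * q (- \<i>) m)) / 4"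
    by (simp only: integral_divide)
  also have "integral (cbox a b) (\<lambda>m. (q 1 m - q (-1) m + \<i> * q \<i> m - \<i> * q (- \<i>) m))
     = integral (cbox a b) (q 1) - integral (cbox a b) (q (-1))
    + \<i> * integral (cbox a b) (q \<i>) - \<i> * integral (cbox a b) (q (- \<i>))"
    using i by (simp add: integral_diff integral_add integrable_diff integrable_add integrable_on_mult_right)
  finally show ?thesis .
qed

section \<open>The two traces on inner products\<close>

context smooth_bimod
begin

lemma ipD_continuous: "f \<in> Xinf \<Longrightarrow> g \<in> Xinf \<Longrightarrow> continuous_on UNIV (\<lambda>m. ipD c \<mu> \<nu> f g m p)"
  by (rule D_alg_continuous[OF ipD_D_alg])

lemma ipE_continuous: "f \<in> Xinf \<Longrightarrow> g \<in> Xinf \<Longrightarrow> continuous_on UNIV (\<lambda>m. ipE c \<mu> \<nu> f g m p)"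
  by (rule E_alg_continuous[OF ipE_E_alg])

lemma ipD_self:
  assumes f: "f \<in> Xinf"
  shows "ipD c \<mu> \<nu> f f (x, y) 0 = of_real (\<Sum>\<^sub>\<infinity>k::int. (cmod (f (x + of_int k, y)))\<^sup>2)"
    and "(\<lambda>k::int. (cmod (f (x + of_int k, y)))\<^sup>2) summable_on UNIV"
proof -
  show s: "(\<lambda>k::int. (cmod (f (x + of_int k, y)))\<^sup>2) summable_on UNIV"
    using Xi_row[OF Xinf_Xi[OF f]] by (simp add: ell2_def)
  have "ipD c \<mu> \<nu> f f (x, y) 0 = (\<Sum>\<^sub>\<infinity>k::int. of_real ((cmod (f (x + of_int k, y)))\<^sup>2))"
    by (simp add: ipD_def complex_norm_square del: of_real_power)
  also have "\<dots> = of_real (\<Sum>\<^sub>\<infinity>k::int. (cmod (f (x + of_int k, y)))\<^sup>2)"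
    using s by (intro infsumI has_sum_of_real) auto
  finally show "ipD c \<mu> \<nu> f f (x, y) 0 = \<dots>" .
qed

lemma ipE_self:
  assumes f: "f \<in> Xinf"
  shows "ipE c \<mu> \<nu> f f (x, y) 0 = of_real (\<Sum>\<^sub>\<infinity>k::int. (cmod (f (x + of_int k * (2 * \<mu>), y + of_int k * (2 * \<nu>))))\<^sup>2)"
    and "(\<lambda>k::int. (cmod (f (x + of_int k * (2 * \<mu>), y + of_int k * (2 * \<nu>))))\<^sup>2) summable_on UNIV"
proof -
  have col: "entry (X f (x, y)) p 0 = f (x + of_int p * (2 * \<mu>), y + of_int p * (2 * \<nu>))" for p
    using f by (simp add: entry_X mod_mat_def mult_ac)
  show s: "(\<lambda>k::int. (cmod (f (x + of_int k * (2 * \<mu>), y + of_int k * (2 * \<nu>))))\<^sup>2) summable_on UNIV"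
    using bdd_mat_col[OF bdd_mat_entry, of "X f (x, y)" 0] by (simp add: ell2_def col)
  have "ipE c \<mu> \<nu> f f (x, y) 0 = (\<Sum>\<^sub>\<infinity>k::int. of_real ((cmod (f (x + of_int k * (2 * \<mu>), y + of_int k * (2 * \<nu>))))\<^sup>2))"
    using f by (simp add: ipE_entry_0 entry_simps col complex_norm_square mult.commute del: of_real_power)
  also have "\<dots> = of_real (\<Sum>\<^sub>\<infinity>k::int. (cmod (f (x + of_int k * (2 * \<mu>), y + of_int k * (2 * \<nu>))))\<^sup>2)"
    using s by (intro infsumI has_sum_of_real) auto
  finally show "ipE c \<mu> \<nu> f f (x, y) 0 = \<dots>" .
qed

text \<open>Both sides are the integral of the squared modulus of \<open>f\<close> over the
  cylinder, folded once along \<open>(1, 0)\<close> and once along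
  \<open>(2 * \<mu>, 2 * \<nu>)\<close>. Nonnegativity permits the exchange of sums and
  integrals.\<close>

lemma tauD_tauE_self:
  assumes f: "f \<in> Xinf" and \<mu>: "0 < \<mu>"
  shows "tauD (ipD c \<mu> \<nu> f f) = tauE \<mu> (ipE c \<mu> \<nu> f f)"
proof -
  define h :: "real \<times> real \<Rightarrow> ennreal" where "h m = ennreal ((cmod (f m))\<^sup>2)" for m
  have [measurable]: "f \<in> borel_measurable borel"
    by (rule Xi_borel[OF Xinf_Xi[OF f]])
  have h: "h \<in> borel_measurable borel"
    unfolding h_def by measurable
  have per: "h (x, y + 1) = h (x, y)" for x y
    by (simp add: h_def Xi_periodic[OF Xinf_Xi[OF f]])
  define d where "d m = Re (ipD c \<mu> \<nu> f f m 0)" for m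
  define e where "e m = Re (ipE c \<mu> \<nu> f f m 0)" for m
  have d: "ipD c \<mu> \<nu> f f m 0 = of_real (d m)" "0 \<le> d m" for m
    by (cases m; simp add: d_def ipD_self[OF f] infsum_nonneg)+
  have e: "ipE c \<mu> \<nu> f f m 0 = of_real (e m)" "0 \<le> e m" for m
    by (cases m; simp add: e_def ipE_self[OF f] infsum_nonneg)+
  have cont: "continuous_on UNIV d" "continuous_on UNIV e"
    unfolding d_def[abs_def] e_def[abs_def]
    by (intro continuous_intros ipD_continuous ipE_continuous f)+
  have dh: "ennreal (d (x, y)) = (\<integral>\<^sup>+k. h (x + of_int k * 1, y + of_int k * 0) \<partial>count_space (UNIV :: int set))" for x y
    unfolding h_def d_def ipD_self(1)[OF f]
    using nn_integral_count_space_infsum[OF ipD_self(2)[OF f], of x y] by simp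
  have eh: "ennreal (e (x, y)) = (\<integral>\<^sup>+k. h (x + of_int k * (2 * \<mu>), y + of_int k * (2 * \<nu>)) \<partial>count_space (UNIV :: int set))" for x y
    unfolding h_def e_def ipE_self(1)[OF f]
    using nn_integral_count_space_infsum[OF ipE_self(2)[OF f], of x y] by simp
  have "ennreal (integral (cbox (0, 0) (1, 1)) d) = ennreal (integral (cbox (0, 0) (2 * \<mu>, 1)) e)"
    using nn_integral_strip_periodization[OF h per zero_less_one, of 0]
      nn_integral_strip_periodization[OF h per, of "2 * \<mu>" "2 * \<nu>"] \<mu>
    by (simp only: nn_integral_box_eq_integral[OF cont(1) d(2), symmetric]
        nn_integral_box_eq_integral[OF cont(2) e(2), symmetric] dh eh)
  then have "integral (cbox (0, 0) (1, 1)) d = integral (cbox (0, 0) (2 * \<mu>, 1)) e"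
    by (subst (asm) ennreal_inj) (auto intro!: integral_nonneg integrable_continuous continuous_on_subset[OF cont(1)]
      continuous_on_subset[OF cont(2)] d e)
  moreover have "tauD (ipD c \<mu> \<nu> f f) = of_real (integral (cbox (0, 0) (1, 1)) d)"
    unfolding tauD_def d(1)
    by (intro integral_complex_of_real integrable_continuous continuous_on_subset[OF cont(1)]) auto
  moreover have "tauE \<mu> (ipE c \<mu> \<nu> f f) = of_real (integral (cbox (0, 0) (2 * \<mu>, 1)) e)"
    unfolding tauE_box[OF ipE_continuous[OF f f]] e(1)
    by (intro integral_complex_of_real integrable_continuous continuous_on_subset[OF cont(2)]) auto
  ultimately show ?thesis
    by simp
qed

text \<open>This is the trace property for the operators \<open>X f m\<close>, obtained from the
  diagonal case by polarization. \<open>ipD\<close> conjugates its second argument and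
  \<open>ipE\<close> its first, so the coefficient of \<open>cnj a\<close> pairs \<open>f\<close>
  with \<open>g\<close> on one side and \<open>g\<close> with \<open>f\<close> on the other.\<close>

lemma tauD_ipD_eq_tauE_ipE:
  assumes f: "f \<in> Xinf" and g: "g \<in> Xinf" and \<mu>: "0 < \<mu>"
  shows "tauD (ipD c \<mu> \<nu> f g) = tauE \<mu> (ipE c \<mu> \<nu> g f)"
proof -
  define w where "w a = (\<lambda>m. f m + a * g m)" for a
  have w: "w a \<in> Xinf" for a
    using Xinf_add[OF f Xinf_cmult[OF g]] by (simp add: w_def plus_fun_def)
  have Xw: "entry (X (w a) m) p k = entry (X f m) p k + a * entry (X g m) p k" for a m p k
    by (simp add: entry_X w f g) (simp add: w_def mod_mat_def case_prod_beta algebra_simps)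
  have s: "(\<lambda>k. entry A p k * cnj (entry B q k)) summable_on UNIV"
    "(\<lambda>k. cnj (entry A k p) * entry B k q) summable_on UNIV" for A B p q
    using entry_mult_summable[of A p "adj B" q] entry_mult_summable[of "adj A" p B q] by simp_all
  have D: "ipD c \<mu> \<nu> (w a) (w a) m 0 = ipD c \<mu> \<nu> f f m 0 + cnj a * ipD c \<mu> \<nu> f g m 0
      + a * ipD c \<mu> \<nu> g f m 0 + a * cnj a * ipD c \<mu> \<nu> g g m 0" for a m
  proof -
    let ?s = "\<lambda>f g. \<Sum>\<^sub>\<infinity>k. entry (X f m) 0 k * cnj (entry (X g m) 0 k)"
    have "ipD c \<mu> \<nu> (w a) (w a) m 0 = (\<Sum>\<^sub>\<infinity>k. entry (X f m) 0 k * cnj (entry (X f m) 0 k)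
        + cnj a * (entry (X f m) 0 k * cnj (entry (X g m) 0 k))
        + a * (entry (X g m) 0 k * cnj (entry (X f m) 0 k))
        + a * cnj a * (entry (X g m) 0 k * cnj (entry (X g m) 0 k)))"
      by (simp add: ipD_entry w entry_simps Xw algebra_simps)
    also have "\<dots> = ?s f f + cnj a * ?s f g + a * ?s g f + a * cnj a * ?s g g"
      by (simp only: infsum_add infsum_cmult_right' summable_on_add summable_on_cmult_right s)
    finally show ?thesis
      by (simp add: ipD_entry f g entry_simps)
  qed
  have E: "ipE c \<mu> \<nu> (w a) (w a) m 0 = ipE c \<mu> \<nu> f f m 0 + a * ipE c \<mu> \<nu> f g m 0
      + cnj a * ipE c \<mu> \<nu> g f m 0 + a * cnj a * ipE c \<mu> \<nu> g g m 0" for a m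
  proof -
    let ?s = "\<lambda>f g. \<Sum>\<^sub>\<infinity>k. cnj (entry (X f m) k 0) * entry (X g m) k 0"
    have "ipE c \<mu> \<nu> (w a) (w a) m 0 = (\<Sum>\<^sub>\<infinity>k. cnj (entry (X f m) k 0) * entry (X f m) k 0
        + a * (cnj (entry (X f m) k 0) * entry (X g m) k 0)
        + cnj a * (cnj (entry (X g m) k 0) * entry (X f m) k 0)
        + a * cnj a * (cnj (entry (X g m) k 0) * entry (X g m) k 0))"
      by (simp add: ipE_entry_0 w entry_simps Xw algebra_simps)
    also have "\<dots> = ?s f f + a * ?s f g + cnj a * ?s g f + a * cnj a * ?s g g"
      by (simp only: infsum_add infsum_cmult_right' summable_on_add summable_on_cmult_right s)
    finally show ?thesis
      by (simp add: ipE_entry_0 f g entry_simps)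
  qed
  have "tauD (ipD c \<mu> \<nu> f g) = (tauD (ipD c \<mu> \<nu> (w 1) (w 1)) - tauD (ipD c \<mu> \<nu> (w (-1)) (w (-1)))
      + \<i> * tauD (ipD c \<mu> \<nu> (w \<i>) (w \<i>)) - \<i> * tauD (ipD c \<mu> \<nu> (w (-\<i>)) (w (-\<i>)))) / 4"
    unfolding tauD_def
  proof (rule integral_polarization[of "\<lambda>a m. ipD c \<mu> \<nu> (w a) (w a) m 0"])
    show "continuous_on UNIV (\<lambda>m. ipD c \<mu> \<nu> (w a) (w a) m 0)" for a
      by (intro ipD_continuous w)
  qed (simp add: D algebra_simps)
  moreover have "tauE \<mu> (ipE c \<mu> \<nu> g f) = (tauE \<mu> (ipE c \<mu> \<nu> (w 1) (w 1)) - tauE \<mu> (ipE c \<mu> \<nu> (w (-1)) (w (-1)))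
      + \<i> * tauE \<mu> (ipE c \<mu> \<nu> (w \<i>) (w \<i>)) - \<i> * tauE \<mu> (ipE c \<mu> \<nu> (w (-\<i>)) (w (-\<i>)))) / 4"
    unfolding tauE_box[OF ipE_continuous[OF w w]] tauE_box[OF ipE_continuous[OF g f]]
  proof (rule integral_polarization[of "\<lambda>a m. ipE c \<mu> \<nu> (w a) (w a) m 0"])
    show "continuous_on UNIV (\<lambda>m. ipE c \<mu> \<nu> (w a) (w a) m 0)" for a
      by (intro ipE_continuous w)
  qed (simp add: E algebra_simps)
  ultimately show ?thesis
    by (simp only: tauD_tauE_self[OF w \<mu>])
qed

end

section \<open>Vanishing of the trace on derivatives\<close>

lemma quotient_has_vector_derivative:
  fixes f :: "real \<Rightarrow> complex"
  assumes "((\<lambda>t. (f (x + t) - f x) / of_real t) \<longlongrightarrow> D) (at 0)"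
  shows "(f has_vector_derivative D) (at x)"
proof -
  have "((\<lambda>t. (f (x + t) - f x) / of_real t - D) \<longlongrightarrow> D - D) (at 0)"
    by (intro tendsto_intros assms)
  then have lim: "((\<lambda>t. norm ((f (x + t) - f x) / of_real t - D)) \<longlongrightarrow> 0) (at 0)"
    by (simp add: tendsto_norm_zero_iff)
  have quot: "norm ((f (x + t) - f x) / of_real t - D) = norm (f (x + t) - f x - t *\<^sub>R D) / \<bar>t\<bar>" if "t \<noteq> 0" for t
  proof -
    have "(f (x + t) - f x) / of_real t - D = (f (x + t) - f x - t *\<^sub>R D) / of_real t"
      using that by (simp add: scaleR_conv_of_real diff_divide_distrib)
    then show ?thesis
      by (simp only: norm_divide norm_of_real)
  qed
  have "((\<lambda>t. norm (f (x + t) - f x - t *\<^sub>R D) / norm t) \<longlongrightarrow> 0) (at 0)"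
    by (rule Lim_transform_eventually[OF lim])
      (auto simp: eventually_at_filter intro!: always_eventually quot)
  then show ?thesis
    unfolding has_vector_derivative_def has_derivative_at
    by (auto intro: bounded_linear_scaleR_left)
qed

text \<open>In degree 0 the multiplication terms of \<open>delta\<close> carry the factor
  \<open>p\<close> and vanish. What remains are partial derivatives of a function periodic in
  \<open>x\<close> and \<open>y\<close>, whose integrals over a period are 0.\<close>

lemma tauD_delta:
  assumes "\<Phi> \<in> D_smooth c \<mu> \<nu>"
  shows "tauD (delta c \<mu> V \<Phi>) = 0"
proof -
  have \<Phi>: "\<Phi> \<in> D_alg c \<mu> \<nu>"
    using assms by (simp add: D_smooth_def)
  obtain G :: "heis list \<Rightarrow> heis \<Rightarrow> cpfun" where G0: "G [] = (\<lambda>h. heis_act c \<mu> h \<Phi>)"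
    and cont: "\<And>v h. v \<in> Basis \<Longrightarrow> ((\<lambda>k. cp_norm (lam \<mu> \<nu>) (G [v] k - G [v] h)) \<longlongrightarrow> 0) (at h)"
    and diff: "\<And>v h. v \<in> Basis \<Longrightarrow> ((\<lambda>t::real. cp_norm (lam \<mu> \<nu>) (\<lambda>m p.
            (G [] (h + t *\<^sub>R v) m p - G [] h m p) / of_real t - G [v] h m p)) \<longlongrightarrow> 0) (at 0)"
  proof -
    from assms obtain G :: "heis list \<Rightarrow> heis \<Rightarrow> cpfun" where G: "G [] = (\<lambda>h. heis_act c \<mu> h \<Phi>)"
      "\<And>vs h. set vs \<subseteq> Basis \<Longrightarrow> ((\<lambda>k. cp_norm (lam \<mu> \<nu>) (G vs k - G vs h)) \<longlongrightarrow> 0) (at h)"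
      "\<And>vs h v. set vs \<subseteq> Basis \<Longrightarrow> v \<in> Basis \<Longrightarrow> ((\<lambda>t::real. cp_norm (lam \<mu> \<nu>) (\<lambda>m p.
            (G vs (h + t *\<^sub>R v) m p - G vs h m p) / of_real t - G (v # vs) h m p)) \<longlongrightarrow> 0) (at 0)"
      unfolding D_smooth_def cp_smooth_def by blast
    show thesis
      by (rule that[of G]) (use G(1) G(2)[of "[v]" for v] G(3)[of "[]"] in auto)
  qed
  \<comment> \<open>At the base point \<open>(0, 0)\<close> the group element
    \<open>(r, s, 0)\<close> turns the degree-0 coefficient into its value at
    \<open>(- r, - s)\<close>. Group derivatives at \<open>(- x, - y, 0)\<close> are thus the
    negatives of the partial derivatives at \<open>(x, y)\<close>.\<close>
  define \<psi> where "\<psi> v z = - G [v] (- fst z, - snd z, 0) (0, 0) 0" for v and z :: "real \<times> real"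
  have \<psi>_cont: "continuous_on UNIV (\<psi> v)" if "v \<in> Basis" for v
  proof -
    have "isCont (\<lambda>h. G [v] h (0, 0) 0) h" for h
    proof -
      have "((\<lambda>k. (G [v] k - G [v] h) (0, 0) 0) \<longlongrightarrow> 0) (at h)"
        by (rule cp_norm_tendsto_0_coeff_tendsto[OF zaction_inv_lam cont[OF that]])
      then show ?thesis
        by (simp add: isCont_def LIM_zero_iff)
    qed
    then have "continuous_on UNIV (\<lambda>h. G [v] h (0, 0) 0)"
      by (simp add: continuous_on_eq_continuous_at)
    then have "continuous_on UNIV (\<lambda>z :: real \<times> real. G [v] (- fst z, - snd z, 0) (0, 0) 0)"
      by (rule continuous_on_compose2) (auto intro!: continuous_intros)
    then show ?thesis
      unfolding \<psi>_def[abs_def] by (rule continuous_on_minus)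
  qed
  have B: "(1, 0, 0) \<in> (Basis :: heis set)" "(0, 1, 0) \<in> (Basis :: heis set)"
    by (auto simp: Basis_prod_def zero_prod_def)
  have act: "heis_act c \<mu> (r, s, 0) \<Phi> (0, 0) 0 = \<Phi> (- r, - s) 0" for r s
    by (simp add: heis_act_def)
  have quot: "((\<lambda>t. (\<Phi> (x + t * a, y + t * b) 0 - \<Phi> (x, y) 0) / of_real t) \<longlongrightarrow> \<psi> (a, b, 0) (x, y)) (at 0)"
    if "(a, b, 0) \<in> (Basis :: heis set)" for a b x y
  proof -
    have "((\<lambda>t. (G [] ((- x, - y, 0) + t *\<^sub>R (a, b, 0)) (0, 0) 0 - G [] (- x, - y, 0) (0, 0) 0) / of_real t
        - G [(a, b, 0)] (- x, - y, 0) (0, 0) 0) \<longlongrightarrow> 0) (at 0)"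
      by (rule cp_norm_tendsto_0_coeff_tendsto[OF zaction_inv_lam diff[OF that]])
    then have "((\<lambda>t. (\<Phi> (x - t * a, y - t * b) 0 - \<Phi> (x, y) 0) / of_real t) \<longlongrightarrow> - \<psi> (a, b, 0) (x, y)) (at 0)"
      by (simp add: G0 act \<psi>_def LIM_zero_iff)
    \<comment> \<open>Replacing \<open>t\<close> by \<open>- t\<close> turns the backward difference
      quotients into forward ones.\<close>
    then have "((\<lambda>t. (\<Phi> (x - (- t) * a, y - (- t) * b) 0 - \<Phi> (x, y) 0) / of_real (- t)) \<longlongrightarrow> - \<psi> (a, b, 0) (x, y)) (at 0)"
      by (rule filterlim_compose) (auto simp: filterlim_at eventually_at_filter intro!: tendsto_eq_intros)
    from tendsto_minus[OF this] show ?thesis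
      by simp
  qed
  define d1 where "d1 = \<psi> (1, 0, 0)"
  define d2 where "d2 = \<psi> (0, 1, 0)"
  have d1: "((\<lambda>s. \<Phi> (s, y) 0) has_vector_derivative d1 (x, y)) (at x)" for x y
    using quot[OF B(1), of x y] by (intro quotient_has_vector_derivative) (simp add: d1_def)
  have d2: "((\<lambda>s. \<Phi> (x, s) 0) has_vector_derivative d2 (x, y)) (at y)" for x y
    using quot[OF B(2), of x y] by (intro quotient_has_vector_derivative) (simp add: d2_def)
  have c1: "continuous_on UNIV d1"
    unfolding d1_def by (rule \<psi>_cont[OF B(1)])
  have c2: "continuous_on UNIV d2"
    unfolding d2_def by (rule \<psi>_cont[OF B(2)])
  have "integral {0..1} (\<lambda>x. d1 (x, y)) = \<Phi> (1, y) 0 - \<Phi> (0, y) 0" for y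
    by (rule integral_unique, rule fundamental_theorem_of_calculus[where f = "\<lambda>s. \<Phi> (s, y) 0"])
      (simp_all add: has_vector_derivative_at_within d1)
  \<comment> \<open>In degree 0 the covariance phase is 1, so covariance is plain periodicity in
    \<open>x\<close>.\<close>
  moreover have "\<Phi> (1, y) 0 = \<Phi> (0, y) 0" for y
    using D_alg_covariant[OF \<Phi>, of 1 0 y 0] by simp
  ultimately have I1: "integral (cbox (0, 0) (1, 1)) d1 = 0"
    using integral_box_iterated[OF c1, of 1] by simp
  have "integral {0..1} (\<lambda>y. d2 (x, y)) = \<Phi> (x, 1) 0 - \<Phi> (x, 0) 0" for x
    by (rule integral_unique, rule fundamental_theorem_of_calculus[where f = "\<lambda>s. \<Phi> (x, s) 0"])
      (simp_all add: has_vector_derivative_at_within d2)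
  moreover have "\<Phi> (x, 1) 0 = \<Phi> (x, 0) 0" for x
    using D_alg_periodic[OF \<Phi>, of x 0 0] by simp
  ultimately have I2: "integral (cbox (0, 0) (1, 1)) d2 = 0"
    by (subst integral_prod_continuous) (auto intro: continuous_on_subset[OF c2])
  obtain v1 v2 v3 where V: "V = (v1, v2, v3)"
    by (cases V)
  have "delta c \<mu> V \<Phi> m 0 = - of_real v1 * d1 m - of_real v2 * d2 m" for m
    by (cases m) (simp add: delta_def V delta_X_def delta_Y_def delta_Z_def
        vector_derivative_at[OF d1] vector_derivative_at[OF d2])
  then have "tauD (delta c \<mu> V \<Phi>) = integral (cbox (0, 0) (1, 1)) (\<lambda>m. - of_real v1 * d1 m - of_real v2 * d2 m)"
    by (simp only: tauD_def)
  also have "\<dots> = integral (cbox (0, 0) (1, 1)) (\<lambda>m. - of_real v1 * d1 m) - integral (cbox (0, 0) (1, 1)) (\<lambda>m. of_real v2 * d2 m)"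
    by (intro integral_diff integrable_on_mult_right box_integrable c1 c2)
  also have "\<dots> = 0"
    by (simp only: integral_mult_right I1 I2) simp
  finally show ?thesis .
qed

section \<open>The topological charge\<close>

lemma tauD_uminus: "(\<And>m. \<Phi> m 0 = - \<Psi> m 0) \<Longrightarrow> tauD \<Phi> = - tauD \<Psi>"
  by (simp add: tauD_def)

lemma tauE_uminus: "(\<And>m. \<Phi> m 0 = - \<Psi> m 0) \<Longrightarrow> tauE \<mu> \<Phi> = - tauE \<mu> \<Psi>"
  by (simp add: tauE_def)

lemma tauE_cong: "(\<And>m. \<Phi> m 0 = \<Psi> m 0) \<Longrightarrow> tauE \<mu> \<Phi> = tauE \<mu> \<Psi>"
  by (simp add: tauE_def)

lemma actE_cp_unit: "actE cp_unit f = f"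
proof (rule ext, clarify)
  fix x y
  have "actE cp_unit f (x, y) = (\<Sum>\<^sub>\<infinity>q::int\<in>{0}. f (x + of_int q, y))"
    unfolding actE_def cp_unit_def prod.case by (rule infsum_cong_neutral) auto
  then show "actE cp_unit f (x, y) = f (x, y)"
    by simp
qed

text \<open>Here \<open>r'\<close>, \<open>a'\<close>, \<open>b'\<close> are the adjoints of \<open>r\<close>, \<open>a\<close>, \<open>b\<close>; the hypotheses express
  \<open>\<langle>R, R\<rangle>\<^sub>L = Id\<close> and its derivatives.\<close>

lemma charge_kernel_identity:
  fixes r r' a a' b b' :: "'a :: ring_1"
  assumes r: "r' * r = 1" and a: "a' * r = - (r' * a)" and b: "b' * r = - (r' * b)"
  shows "r * r' * ((a * r' + r * a') * (b * r' + r * b') - (b * r' + r * b') * (a * r' + r * a'))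
    = (r * r' * a * r' * b - r * r' * b * r' * a + r * a' * b - r * b' * a) * r'"
proof -
  have r_l: "r' * (r * x) = x" and a_l: "a' * (r * x) = - (r' * (a * x))" and b_l: "b' * (r * x) = - (r' * (b * x))" for x
    using assms by (simp_all flip: mult.assoc)
  show ?thesis
    by (simp add: algebra_simps r_l a_l b_l r a b)
qed

section \<open>Tracing the charge kernel inside the bimodule\<close>

context smooth_bimod
begin

text \<open>A relation rather than a map, so that sums, differences and products of coefficient
  functions are represented without first being placed in \<open>D_alg\<close>.\<close>

definition rep :: "cpfun \<Rightarrow> (real \<times> real \<Rightarrow> bmat) \<Rightarrow> bool" where
  "rep \<Phi> A \<longleftrightarrow> (\<forall>m. reg_mat (lam \<mu> \<nu>) \<Phi> m = entry (A m))"

lemma rep_ipD: "f \<in> Xinf \<Longrightarrow> g \<in> Xinf \<Longrightarrow> rep (ipD c \<mu> \<nu> f g) (\<lambda>m. X f m * adj (X g m))"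
  by (simp add: rep_def reg_mat_ipD del: split_paired_All)

lemma rep_add: "rep \<Phi> A \<Longrightarrow> rep \<Psi> B \<Longrightarrow> rep (\<Phi> + \<Psi>) (\<lambda>m. A m + B m)"
  by (simp add: rep_def reg_mat_def entry_simps fun_eq_iff del: split_paired_All)

lemma rep_diff: "rep \<Phi> A \<Longrightarrow> rep \<Psi> B \<Longrightarrow> rep (\<Phi> - \<Psi>) (\<lambda>m. A m - B m)"
  by (simp add: rep_def reg_mat_def entry_simps fun_eq_iff del: split_paired_All)

lemma rep_mult: "rep \<Phi> A \<Longrightarrow> rep \<Psi> B \<Longrightarrow> rep (cp_mult (lam \<mu> \<nu>) \<Phi> \<Psi>) (\<lambda>m. A m * B m)"
  by (simp add: rep_def reg_mat_cp_mult entry_simps fun_eq_iff del: split_paired_All)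

lemma rep_coeff: "rep \<Phi> A \<Longrightarrow> \<Phi> m 0 = entry (A m) 0 0"
proof -
  have "lam \<mu> \<nu> 0 m = m"
    by (cases m) (simp add: lam_def)
  then show "rep \<Phi> A \<Longrightarrow> \<Phi> m 0 = entry (A m) 0 0"
    unfolding rep_def reg_mat_def by (metis diff_self)
qed

lemma tauD_add:
  assumes "f \<in> Xinf" "g \<in> Xinf" "h \<in> Xinf" "k \<in> Xinf"
  shows "tauD (ipD c \<mu> \<nu> f g + ipD c \<mu> \<nu> h k) = tauD (ipD c \<mu> \<nu> f g) + tauD (ipD c \<mu> \<nu> h k)"
  unfolding tauD_def by (simp add: integral_add box_integrable ipD_continuous assms)

lemma tauD_ipD_diff:
  assumes "f \<in> Xinf" "g \<in> Xinf" "h \<in> Xinf"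
  shows "tauD (ipD c \<mu> \<nu> (f - g) h) = tauD (ipD c \<mu> \<nu> f h) - tauD (ipD c \<mu> \<nu> g h)"
proof -
  have "ipD c \<mu> \<nu> (f - g) h m 0 = ipD c \<mu> \<nu> f h m 0 - ipD c \<mu> \<nu> g h m 0" for m
    using assms by (simp add: ipD_entry X_diff Xinf_diff left_diff_distrib entry_simps(5))
  then show ?thesis
    unfolding tauD_def using assms by (simp add: integral_diff box_integrable ipD_continuous)
qed

lemma tauD_ipD_add:
  assumes "f \<in> Xinf" "g \<in> Xinf" "h \<in> Xinf"
  shows "tauD (ipD c \<mu> \<nu> (f + g) h) = tauD (ipD c \<mu> \<nu> f h) + tauD (ipD c \<mu> \<nu> g h)"
proof -
  have "ipD c \<mu> \<nu> (f + g) h m 0 = ipD c \<mu> \<nu> f h m 0 + ipD c \<mu> \<nu> g h m 0" for m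
    using assms by (simp add: ipD_entry X_add Xinf_add distrib_right entry_simps(3))
  then show ?thesis
    unfolding tauD_def using assms by (simp add: integral_add box_integrable ipD_continuous)
qed

text \<open>The left inner product at the integer translates of \<open>m\<close> in \<open>x\<close>
  supplies all rows of the matrix, not only row 0.\<close>

lemma X_unit:
  assumes "r \<in> Xinf" and "ipE c \<mu> \<nu> r r = cp_unit"
  shows "adj (X r m) * X r m = 1"
proof (rule bmat_eqI)
  fix k l
  have "entry (adj (X r m) * X r m) k l = ipE c \<mu> \<nu> r r (fst m + of_int k, snd m) (l - k)"
    by (simp add: ipE_entry assms(1))
  then show "entry (adj (X r m) * X r m) k l = entry 1 k l"
    by (auto simp: assms(2) cp_unit_def entry_simps)
qed

text \<open>Compatibility only says that the sum of the two left inner products acts as 0 on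
  \<open>r\<close>. By bimodule associativity this action gives the element \<open>g\<close> of
  \<open>Xinf\<close>; since \<open>g\<close> vanishes at all points, so does the whole matrix
  \<open>X g m\<close>, and multiplying by \<open>adj (X r m)\<close> cancels the leading
  \<open>X r m\<close>.\<close>

lemma X_skew:
  assumes r: "r \<in> Xinf" and a: "a \<in> Xinf" and unit: "ipE c \<mu> \<nu> r r = cp_unit"
    and zero: "actE (ipE c \<mu> \<nu> a r + ipE c \<mu> \<nu> r a) r = 0"
  shows "adj (X a m) * X r m = - (adj (X r m) * X a m)"
proof -
  define g where "g = actD \<mu> \<nu> a (ipD c \<mu> \<nu> r r) + actD \<mu> \<nu> r (ipD c \<mu> \<nu> a r)"
  have g: "g \<in> Xinf"
    unfolding g_def by (intro Xinf_add Xinf_triple a r)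
  have Xg: "X g m = X r m * adj (X r m) * X a m + X r m * adj (X a m) * X r m" for m
    unfolding g_def by (simp add: X_add X_triple Xinf_triple a r)
  have "g m = 0" for m
  proof -
    have "actE (ipE c \<mu> \<nu> a r + ipE c \<mu> \<nu> r a) r m = entry (X r m * adj (adj (X a m) * X r m + adj (X r m) * X a m)) 0 0"
      by (rule actE_entry[OF r]) (simp add: ipE_entry_0 a r entry_simps(3))
    also have "\<dots> = entry (X g m) 0 0"
      by (simp add: Xg adj_simps algebra_simps)
    also have "\<dots> = g m"
      using g by (cases m) (simp add: entry_X mod_mat_0)
    finally show ?thesis
      using zero by simp
  qed
  then have "adj (X r m) * (X r m * adj (X r m) * X a m + X r m * adj (X a m) * X r m) = 0"
    using X_zero_iff[OF g] Xg by (metis mult_zero_right)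
  moreover have "adj (X r m) * (X r m * x) = x" for x
    using X_unit[OF r unit, of m] by (simp flip: mult.assoc)
  ultimately show ?thesis
    by (simp add: distrib_left mult.assoc eq_neg_iff_add_eq_0 add.commute)
qed

text \<open>With \<open>s\<close> and \<open>t\<close> standing for \<open>adj (X r m)\<close> times
  \<open>X a m\<close> and \<open>X b m\<close>, the kernel splits into four terms. Those containing
  \<open>s t\<close> and \<open>t s\<close> have equal trace, and in the other two the isometry
  \<open>X r m\<close> drops out by the trace property.\<close>

lemma tauD_charge_kernel:
  assumes r: "r \<in> Xinf" and a: "a \<in> Xinf" and b: "b \<in> Xinf" and \<mu>: "0 < \<mu>"
    and unit: "ipE c \<mu> \<nu> r r = cp_unit"
    and skew_a: "\<And>m. adj (X a m) * X r m = - (adj (X r m) * X a m)"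
    and skew_b: "\<And>m. adj (X b m) * X r m = - (adj (X r m) * X b m)"
    and dV: "dV = ipD c \<mu> \<nu> a r + ipD c \<mu> \<nu> r a" and dW: "dW = ipD c \<mu> \<nu> b r + ipD c \<mu> \<nu> r b"
  shows "tauD (cp_mult (lam \<mu> \<nu>) (ipD c \<mu> \<nu> r r)
      (cp_mult (lam \<mu> \<nu>) dV dW - cp_mult (lam \<mu> \<nu>) dW dV))
    = tauD (ipD c \<mu> \<nu> b a) - tauD (ipD c \<mu> \<nu> a b)"
proof -
  let ?t = "\<lambda>f g h. actD \<mu> \<nu> f (ipD c \<mu> \<nu> g h)"
  \<comment> \<open>By \<open>X_triple\<close> the matrices of \<open>f1\<close> to
    \<open>f4\<close> are, up to sign, the four summands of \<open>charge_kernel_identity\<close>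
    before the final factor \<open>adj (X r m)\<close>; \<open>u\<close> and \<open>w\<close> supply
    the longer products.\<close>
  define u where "u = ?t a r r"
  define w where "w = ?t b r r"
  define f1 where "f1 = ?t b r u"
  define f2 where "f2 = ?t a r w"
  define f3 where "f3 = ?t b a r"
  define f4 where "f4 = ?t a b r"
  have mem: "u \<in> Xinf" "w \<in> Xinf" "f1 \<in> Xinf" "f2 \<in> Xinf" "f3 \<in> Xinf" "f4 \<in> Xinf"
    unfolding u_def w_def f1_def f2_def f3_def f4_def by (intro Xinf_triple a b r)+
  have Xu: "X u m = X r m * adj (X r m) * X a m" and Xw: "X w m = X r m * adj (X r m) * X b m" for m
    unfolding u_def w_def by (simp_all add: X_triple a b r)
  have Xf: "X f1 m = X r m * adj (X r m) * X a m * adj (X r m) * X b m"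
    "X f2 m = X r m * adj (X r m) * X b m * adj (X r m) * X a m"
    "X f3 m = X r m * adj (X a m) * X b m" "X f4 m = X r m * adj (X b m) * X a m" for m
    unfolding f1_def f2_def f3_def f4_def by (simp_all add: X_triple a b r mem Xu Xw)
  have unit_l: "adj (X r m) * (X r m * x) = x" for x m
    using X_unit[OF r unit, of m] by (simp flip: mult.assoc)
  have skew_l: "adj (X a m) * (X r m * x) = - (adj (X r m) * (X a m * x))"
    "adj (X b m) * (X r m * x) = - (adj (X r m) * (X b m * x))" for x m
    using skew_a[of m] skew_b[of m] by (simp_all flip: mult.assoc)
  let ?K = "cp_mult (lam \<mu> \<nu>) (ipD c \<mu> \<nu> r r) (cp_mult (lam \<mu> \<nu>) dV dW - cp_mult (lam \<mu> \<nu>) dW dV)"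
  have K: "?K m 0 = ipD c \<mu> \<nu> f1 r m 0 - ipD c \<mu> \<nu> f2 r m 0 + ipD c \<mu> \<nu> f3 r m 0 - ipD c \<mu> \<nu> f4 r m 0" for m
  proof -
    have rV: "rep dV (\<lambda>m. X a m * adj (X r m) + X r m * adj (X a m))"
      and rW: "rep dW (\<lambda>m. X b m * adj (X r m) + X r m * adj (X b m))"
      unfolding dV dW by (intro rep_add rep_ipD a b r)+
    have "?K m 0 = entry (X r m * adj (X r m)
        * ((X a m * adj (X r m) + X r m * adj (X a m)) * (X b m * adj (X r m) + X r m * adj (X b m))
         - (X b m * adj (X r m) + X r m * adj (X b m)) * (X a m * adj (X r m) + X r m * adj (X a m)))) 0 0"
      by (rule rep_coeff[OF rep_mult[OF rep_ipD[OF r r] rep_diff[OF rep_mult[OF rV rW] rep_mult[OF rW rV]]]])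
    also have "\<dots> = entry ((X f1 m - X f2 m + X f3 m - X f4 m) * adj (X r m)) 0 0"
      unfolding charge_kernel_identity[OF X_unit[OF r unit] skew_a skew_b] Xf ..
    finally show ?thesis
      by (simp add: ipD_entry mem r left_diff_distrib distrib_right entry_simps(3,5))
  qed
  have "tauD ?K = tauD (ipD c \<mu> \<nu> f1 r) - tauD (ipD c \<mu> \<nu> f2 r) + tauD (ipD c \<mu> \<nu> f3 r) - tauD (ipD c \<mu> \<nu> f4 r)"
    unfolding tauD_def K
    by (simp add: integral_add integral_diff integrable_add integrable_diff box_integrable ipD_continuous mem r)
  moreover have "tauD (ipD c \<mu> \<nu> f3 r) = tauD (ipD c \<mu> \<nu> b a)"
  proof -
    \<comment> \<open>Passing to the left inner product brings \<open>adj (X r m)\<close> to the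
      front, where it cancels \<open>X r m\<close>.\<close>
    have "ipE c \<mu> \<nu> r f3 m 0 = ipE c \<mu> \<nu> a b m 0" for m
      by (simp add: ipE_entry_0 mem r a b Xf mult.assoc unit_l)
    then show ?thesis
      by (simp add: tauD_ipD_eq_tauE_ipE mem a b r \<mu> cong: tauE_cong)
  qed
  moreover have "tauD (ipD c \<mu> \<nu> f4 r) = tauD (ipD c \<mu> \<nu> a b)"
  proof -
    have "ipE c \<mu> \<nu> r f4 m 0 = ipE c \<mu> \<nu> b a m 0" for m
      by (simp add: ipE_entry_0 mem r a b Xf mult.assoc unit_l)
    then show ?thesis
      by (simp add: tauD_ipD_eq_tauE_ipE mem a b r \<mu> cong: tauE_cong)
  qed
  moreover have "tauD (ipD c \<mu> \<nu> f1 r) = tauD (ipD c \<mu> \<nu> f2 r)"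
  proof -
    \<comment> \<open>By skewness, the pairing of \<open>u\<close> and \<open>w\<close> is minus the
      term of \<open>f1\<close> when read on the right and minus the term of \<open>f2\<close> when
      read on the left; the trace property equates the two readings.\<close>
    have "tauD (ipD c \<mu> \<nu> u w) = - tauD (ipD c \<mu> \<nu> f1 r)"
      by (rule tauD_uminus) (simp add: ipD_entry mem r Xf Xu Xw adj_simps mult.assoc skew_l entry_simps(4))
    moreover have "tauE \<mu> (ipE c \<mu> \<nu> w u) = - tauE \<mu> (ipE c \<mu> \<nu> r f2)"
      by (rule tauE_uminus)
        (simp add: ipE_entry_0 mem r Xf Xu Xw adj_simps mult.assoc unit_l skew_l entry_simps(4))
    ultimately show ?thesis
      by (simp add: tauD_ipD_eq_tauE_ipE mem r \<mu>)
  qed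
  ultimately show ?thesis
    by simp
qed

end

theorem theorem4p3:
  fixes c :: int and \<mu> \<nu> :: real
    and Einf :: "cpfun set" and Xinf :: "mfun set"
    and R :: mfun and P :: cpfun and N :: "heis \<Rightarrow> mfun \<Rightarrow> mfun"
  assumes "0 < c" and "0 < \<mu>"
    and "smooth_bimodule c \<mu> \<nu> Einf Xinf"
    and "R \<in> Xinf"
    and "P = ipD c \<mu> \<nu> R R" and "projD c \<mu> \<nu> P"
    and "ipE c \<mu> \<nu> R R = cp_unit"
    and "is_connection c \<mu> \<nu> Xinf N" and "is_compatible c \<mu> \<nu> Xinf N"
  shows "top_charge c \<mu> \<nu> P =
    - (1 / (2 * of_real pi * \<i>)) * tauE \<mu> (ipE c \<mu> \<nu> R
        (curvature c N hX hY R + N (heis_bracket c hX hY) R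
          + curvature c N hX hZ R + curvature c N hY hZ R))"
proof -
  interpret smooth_bimod c \<mu> \<nu> Einf Xinf
    by (rule smooth_bimod.intro) (rule assms(3))
  note R = assms(4) and unit = assms(7)
  have N: "N V \<xi> \<in> Xinf" if "\<xi> \<in> Xinf" for V \<xi>
    using assms(8) that unfolding is_connection_def by blast
  have N0: "N 0 R = 0"
  proof -
    have "N (0 *\<^sub>R 0) R = (\<lambda>m. of_real 0 * N 0 R m)"
      using assms(8) R unfolding is_connection_def by blast
    then show ?thesis
      by (simp add: zero_fun_def)
  qed
  have dD: "delta c \<mu> V (ipD c \<mu> \<nu> \<xi> \<eta>) = ipD c \<mu> \<nu> (N V \<xi>) \<eta> + ipD c \<mu> \<nu> \<xi> (N V \<eta>)"
    if "\<xi> \<in> Xinf" "\<eta> \<in> Xinf" for V \<xi> \<eta>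
    using assms(9) that unfolding is_compatible_def by blast
  \<comment> \<open>The unit acts as the identity, so its commutator with \<open>N V\<close> is 0;
    compatibility then provides the vanishing that \<open>X_skew\<close> requires.\<close>
  have skew: "adj (X (N V R) m) * X R m = - (adj (X R m) * X (N V R) m)" for V m
  proof (rule X_skew[OF R N[OF R] unit])
    have "actE (ipE c \<mu> \<nu> (N V R) R + ipE c \<mu> \<nu> R (N V R)) R = deltaE N V (ipE c \<mu> \<nu> R R) R"
      using assms(9) R unfolding is_compatible_def by metis
    then show "actE (ipE c \<mu> \<nu> (N V R) R + ipE c \<mu> \<nu> R (N V R)) R = 0"
      by (simp add: unit deltaE_def actE_cp_unit)
  qed
  let ?d = "\<lambda>V W. tauD (ipD c \<mu> \<nu> (N V R) (N W R))"
  have charge: "charge2 c \<mu> \<nu> V W P = 1 / (2 * of_real pi * \<i>) * (?d W V - ?d V W)" for V W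
    unfolding charge2_def assms(5)
    by (subst tauD_charge_kernel[OF R N[OF R, of V] N[OF R, of W] assms(2) unit skew skew dD[OF R R] dD[OF R R]]) simp
  \<comment> \<open>Integration by parts: the trace of a derivative vanishes, and compatibility
    expands that derivative.\<close>
  have second: "tauD (ipD c \<mu> \<nu> (N V (N W R)) R) = - ?d W V" for V W
  proof -
    have "0 = tauD (delta c \<mu> V (ipD c \<mu> \<nu> (N W R) R))"
      by (rule tauD_delta[OF ipD_smooth[OF N[OF R] R], symmetric])
    also have "\<dots> = tauD (ipD c \<mu> \<nu> (N V (N W R)) R) + ?d W V"
      by (simp only: dD[OF N[OF R] R] tauD_add N R)
    finally show ?thesis
      by (simp add: eq_neg_iff_add_eq_0)
  qed
  \<comment> \<open>The commutator is the curvature plus \<open>N\<close> at the bracket, so the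
    bracket term added for the first pair cancels the one subtracted in
    \<open>curvature\<close>.\<close>
  define C where "C V W = N V (N W R) - N W (N V R)" for V W
  have C: "C V W \<in> Xinf" for V W
    unfolding C_def by (intro Xinf_diff N R)
  have tauC: "tauD (ipD c \<mu> \<nu> (C V W) R) = ?d V W - ?d W V" for V W
    unfolding C_def by (simp add: tauD_ipD_diff N R second)
  \<comment> \<open>\<open>hZ\<close> is central, so for the other two pairs the curvature is the
    commutator itself.\<close>
  have "heis_bracket c hX hZ = 0" "heis_bracket c hY hZ = 0"
    by (simp_all add: heis_bracket_def hX_def hY_def hZ_def zero_prod_def)
  then have "curvature c N hX hY R + N (heis_bracket c hX hY) R + curvature c N hX hZ R + curvature c N hY hZ R
      = C hX hY + C hX hZ + C hY hZ"
    by (simp add: curvature_def C_def N0)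
  then have "tauE \<mu> (ipE c \<mu> \<nu> R
        (curvature c N hX hY R + N (heis_bracket c hX hY) R + curvature c N hX hZ R + curvature c N hY hZ R))
      = tauD (ipD c \<mu> \<nu> (C hX hY + C hX hZ + C hY hZ) R)"
    by (simp add: tauD_ipD_eq_tauE_ipE Xinf_add C R assms(2))
  also have "\<dots> = (?d hX hY - ?d hY hX) + (?d hX hZ - ?d hZ hX) + (?d hY hZ - ?d hZ hY)"
    by (simp add: tauD_ipD_add Xinf_add C R tauC)
  finally have tauE: "tauE \<mu> (ipE c \<mu> \<nu> R
        (curvature c N hX hY R + N (heis_bracket c hX hY) R + curvature c N hX hZ R + curvature c N hY hZ R)) = \<dots>" .
  \<comment> \<open>The charge takes each pair of traces in the order opposite to that of the
    commutator, which is the source of the minus sign.\<close>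
  have lin: "k * (x' - x) + k * (y' - y) + k * (z' - z) = - k * ((x - x') + (y - y') + (z - z'))"
    for k x x' y y' z z' :: complex
    by (simp add: algebra_simps)
  show ?thesis
    unfolding top_charge_def charge tauE by (rule lin)
qed

end
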